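(* Let $\mathcal{H}$ be a complex Hilbert space and let $A,B$ be bounded positive operators on $\mathcal{H}$ such that $A\leq B$. The following assertions are equivalent: (i) $A=[A]B$; (ii) there is an orthogonal projection $P$ on the auxiliary Hilbert space $\mathcal{H}_B$ such that $A=J_BPJ_B^*$; (iii) $A$ is an extreme point of the (convex) operator interval $[0,B]$; (iv) $A$ and $B-A$ are singular.
   Context: A bounded linear operator $A$ on $\mathcal{H}$ is positive, $A\in\mathbf{B}_+(\mathcal{H})$, if $(Ax\,|\,x)\geq 0$ for all $x\in\mathcal{H}$; $A\leq B$ means $B-A$ is positive. For positive $S\le T$, $[S,T]=\{C\in\mathbf{B}_+(\mathcal{H}) : S\leq C\leq T\}$. Parallel sum: for $A,B\in\mathbf{B}_+(\mathcal{H})$, $A:B$ is the unique positive operator with $((A:B)x\,|\,x)=\inf_{y\in\mathcal{H}}\{(A(x-y)\,|\,x-y)+(By\,|\,y)\}$ for all $x\in\mathcal{H}$. Generalized short: $[A]B:=\sup_{n\in\mathbb{N}}B:(nA)$, the strong limit of the increasing sequence $(B:(nA))_n$, which is bounded above by $B$. Singularity: positive operators $A$ and $B$ are singular if $C\leq A$ and $C\leq B$ imply $C=0$ for every $C\in\mathbf{B}_+(\mathcal{H})$; equivalently, $\operatorname{ran}A^{1/2}\cap\operatorname{ran}B^{1/2}=\{0\}$; equivalently, $A:B=0$. Auxiliary space: for $B\in\mathbf{B}_+(\mathcal{H})$, $\mathcal{H}_B$ is the Hilbert space completion of $\operatorname{ran}B$ with the inner product $\langle Bx\,|\,By\rangle_B=(Bx\,|\,y)$,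 $x,y\in\mathcal{H}$. The operator $J_B:\mathcal{H}_B\to\mathcal{H}$ is the bounded extension of the map $Bx\mapsto Bx$ from $\operatorname{ran}B\subseteq\mathcal{H}_B$ to $\mathcal{H}$; its adjoint $J_B^*:\mathcal{H}\to\mathcal{H}_B$ satisfies $J_B^*x=Bx$ for $x\in\mathcal{H}$, and $J_BJ_B^*=B$. *)

theory Defs
  imports "HOL-Analysis.Analysis"
begin

section \<open>Complex Hilbert spaces\<close>

text \<open>
  The underlying real Hilbert space structure (norm, metric, topology) is inherited from the
  library; the last two assumptions tie it to the complex structure, so that
  \<open>norm x = sqrt (Re (cinner x x))\<close>. The inner product is linear in its first argument.
\<close>

class complex_hilbert_space = real_inner + complete_space +
  fixes scaleC :: "complex \<Rightarrow> 'a \<Rightarrow> 'a"  (infixr \<open>*\<^sub>C\<close> 75)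
    and cinner :: "'a \<Rightarrow> 'a \<Rightarrow> complex"
  assumes scaleC_add_right: "c *\<^sub>C (x + y) = c *\<^sub>C x + c *\<^sub>C y"
    and scaleC_add_left: "(c + d) *\<^sub>C x = c *\<^sub>C x + d *\<^sub>C x"
    and scaleC_scaleC: "c *\<^sub>C d *\<^sub>C x = (c * d) *\<^sub>C x"
    and scaleC_one: "1 *\<^sub>C x = x"
    and cinner_add_left: "cinner (x + y) z = cinner x z + cinner y z"
    and cinner_scaleC_left: "cinner (c *\<^sub>C x) y = c * cinner x y"
    and cinner_commute: "cinner x y = cnj (cinner y x)"
    and scaleR_scaleC: "r *\<^sub>R x = complex_of_real r *\<^sub>C x"
    and inner_cinner: "inner x y = Re (cinner x y)"

instantiation complex :: complex_hilbert_space
begin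

definition "scaleC (c::complex) (z::complex) = c * z"
definition "cinner (z::complex) (w::complex) = z * cnj w"

instance
  by standard
    (auto simp: scaleC_complex_def cinner_complex_def algebra_simps scaleR_conv_of_real inner_complex_def)

end


section \<open>Positive operators\<close>

text \<open>
  The type \<open>'a \<Rightarrow>\<^sub>L 'a\<close> consists of the bounded real-linear operators; complex
  linearity is part of the predicate \<open>positive_op\<close>.
\<close>

definition complex_linear_op :: "('a::complex_hilbert_space \<Rightarrow>\<^sub>L 'a) \<Rightarrow> bool" where
  "complex_linear_op A \<longleftrightarrow> (\<forall>c x. A (c *\<^sub>C x) = c *\<^sub>C A x)"

definition positive_op :: "('a::complex_hilbert_space \<Rightarrow>\<^sub>L 'a) \<Rightarrow> bool" where
  "positive_op A \<longleftrightarrow> complex_linear_op A \<and> (\<forall>x. cinner (A x) x \<in> \<real>\<^sub>\<ge>\<^sub>0)"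

definition op_le :: "('a::complex_hilbert_space \<Rightarrow>\<^sub>L 'a) \<Rightarrow> ('a \<Rightarrow>\<^sub>L 'a) \<Rightarrow> bool"  (infix \<open>\<preceq>\<close> 50) where
  "A \<preceq> B \<longleftrightarrow> positive_op (B - A)"

definition op_interval ::
    "('a::complex_hilbert_space \<Rightarrow>\<^sub>L 'a) \<Rightarrow> ('a \<Rightarrow>\<^sub>L 'a) \<Rightarrow> ('a \<Rightarrow>\<^sub>L 'a) set" where
  "op_interval S T = {C. positive_op C \<and> S \<preceq> C \<and> C \<preceq> T}"

lemma positive_op_convex_comb:
  assumes "positive_op S" "positive_op T" "0 \<le> u" "0 \<le> v"
  shows "positive_op (u *\<^sub>R S + v *\<^sub>R T)"
  using assms
  by (auto simp: positive_op_def complex_linear_op_def blinfun.add_left blinfun.scaleR_left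
      scaleR_scaleC scaleC_scaleC scaleC_add_right cinner_add_left cinner_scaleC_left mult.commute
      intro!: nonneg_Reals_add_I nonneg_Reals_mult_I)

lemma convex_op_interval: "convex (op_interval S T)"
proof (rule convexI)
  fix C D and u v :: real
  assume C: "C \<in> op_interval S T" and D: "D \<in> op_interval S T"
    and uv: "0 \<le> u" "0 \<le> v" "u + v = 1"
  have v: "v = 1 - u" using uv by simp
  have "u *\<^sub>R C + v *\<^sub>R D - S = u *\<^sub>R (C - S) + v *\<^sub>R (D - S)"
    and "T - (u *\<^sub>R C + v *\<^sub>R D) = u *\<^sub>R (T - C) + v *\<^sub>R (T - D)"
    by (simp_all add: v algebra_simps)
  then show "u *\<^sub>R C + v *\<^sub>R D \<in> op_interval S T"
    using C D uv positive_op_convex_comb by (auto simp: op_interval_def op_le_def)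
qed

definition parallel_sum ::
    "('a::complex_hilbert_space \<Rightarrow>\<^sub>L 'a) \<Rightarrow> ('a \<Rightarrow>\<^sub>L 'a) \<Rightarrow> 'a \<Rightarrow>\<^sub>L 'a" where
  "parallel_sum A B = (THE C. positive_op C \<and>
     (\<forall>x. cinner (C x) x =
        complex_of_real (INF y. Re (cinner (A (x - y)) (x - y)) + Re (cinner (B y) y))))"

text \<open>\<open>generalized_short A B\<close> is \<open>[A]B\<close>, the strong limit of \<open>B : (nA)\<close>.\<close>

definition generalized_short ::
    "('a::complex_hilbert_space \<Rightarrow>\<^sub>L 'a) \<Rightarrow> ('a \<Rightarrow>\<^sub>L 'a) \<Rightarrow> 'a \<Rightarrow>\<^sub>L 'a" where
  "generalized_short A B =
     (THE C :: 'a \<Rightarrow>\<^sub>L 'a. \<forall>x. (\<lambda>n. parallel_sum B (real n *\<^sub>R A) x) \<longlonglongrightarrow> blinfun_apply C x)"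

definition singular_ops :: "('a::complex_hilbert_space \<Rightarrow>\<^sub>L 'a) \<Rightarrow> ('a \<Rightarrow>\<^sub>L 'a) \<Rightarrow> bool" where
  "singular_ops A B \<longleftrightarrow> (\<forall>C. positive_op C \<longrightarrow> C \<preceq> A \<longrightarrow> C \<preceq> B \<longrightarrow> C = 0)"


section \<open>Inner product spaces with explicit carrier and their completion\<close>

text \<open>
  The auxiliary space depends on an operator and hence cannot be a type; it is represented by a
  carrier set together with its operations, which are meaningful on the carrier only.
\<close>

record 'v cip_space =
  Carr :: "'v set"
  Add :: "'v \<Rightarrow> 'v \<Rightarrow> 'v"
  Scale :: "complex \<Rightarrow> 'v \<Rightarrow> 'v"
  Ip :: "'v \<Rightarrow> 'v \<Rightarrow> complex"

definition cip_norm :: "'v cip_space \<Rightarrow> 'v \<Rightarrow> real" where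
  "cip_norm V u = sqrt (Re (Ip V u u))"

definition cip_dist :: "'v cip_space \<Rightarrow> 'v \<Rightarrow> 'v \<Rightarrow> real" where
  "cip_dist V u v = cip_norm V (Add V u (Scale V (-1) v))"

definition cip_Cauchy :: "'v cip_space \<Rightarrow> (nat \<Rightarrow> 'v) set" where
  "cip_Cauchy V = {s. (\<forall>n. s n \<in> Carr V) \<and>
     (\<forall>e>0. \<exists>N. \<forall>m\<ge>N. \<forall>n\<ge>N. cip_dist V (s m) (s n) < e)}"

definition cip_equiv :: "'v cip_space \<Rightarrow> ((nat \<Rightarrow> 'v) \<times> (nat \<Rightarrow> 'v)) set" where
  "cip_equiv V = {(s, t). s \<in> cip_Cauchy V \<and> t \<in> cip_Cauchy V \<and>
     (\<lambda>n. cip_dist V (s n) (t n)) \<longlonglongrightarrow> 0}"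

definition cip_class :: "'v cip_space \<Rightarrow> (nat \<Rightarrow> 'v) \<Rightarrow> (nat \<Rightarrow> 'v) set" where
  "cip_class V s = cip_equiv V `` {s}"

definition cip_rep :: "(nat \<Rightarrow> 'v) set \<Rightarrow> nat \<Rightarrow> 'v" where
  "cip_rep X = (SOME s. s \<in> X)"

definition cip_completion :: "'v cip_space \<Rightarrow> (nat \<Rightarrow> 'v) set cip_space" where
  "cip_completion V = \<lparr>
     Carr = cip_Cauchy V // cip_equiv V,
     Add = (\<lambda>X Y. cip_class V (\<lambda>n. Add V (cip_rep X n) (cip_rep Y n))),
     Scale = (\<lambda>c X. cip_class V (\<lambda>n. Scale V c (cip_rep X n))),
     Ip = (\<lambda>X Y. lim (\<lambda>n. Ip V (cip_rep X n) (cip_rep Y n)))\<rparr>"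

definition orthogonal_projection_on :: "'v cip_space \<Rightarrow> ('v \<Rightarrow> 'v) \<Rightarrow> bool" where
  "orthogonal_projection_on V P \<longleftrightarrow>
     (\<forall>u\<in>Carr V. P u \<in> Carr V) \<and>
     (\<forall>u\<in>Carr V. \<forall>v\<in>Carr V. P (Add V u v) = Add V (P u) (P v)) \<and>
     (\<forall>c. \<forall>u\<in>Carr V. P (Scale V c u) = Scale V c (P u)) \<and>
     (\<exists>M. \<forall>u\<in>Carr V. cip_norm V (P u) \<le> M * cip_norm V u) \<and>
     (\<forall>u\<in>Carr V. P (P u) = P u) \<and>
     (\<forall>u\<in>Carr V. \<forall>v\<in>Carr V. Ip V (P u) v = Ip V u (P v))"


section \<open>The auxiliary space of a positive operator\<close>

text \<open>
  The inner product is \<open>\<langle>B x | B y\<rangle> = (B x | y)\<close>; for positive \<open>B\<close> the value does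
  not depend on the preimage \<open>y\<close> picked by \<open>inv\<close>.
\<close>

definition range_space :: "('a::complex_hilbert_space \<Rightarrow>\<^sub>L 'a) \<Rightarrow> 'a cip_space" where
  "range_space B = \<lparr>
     Carr = range (blinfun_apply B),
     Add = (+),
     Scale = scaleC,
     Ip = (\<lambda>u v. cinner u (inv (blinfun_apply B) v))\<rparr>"

definition aux_space :: "('a::complex_hilbert_space \<Rightarrow>\<^sub>L 'a) \<Rightarrow> (nat \<Rightarrow> 'a) set cip_space" where
  "aux_space B = cip_completion (range_space B)"

text \<open>
  \<open>aux_J B\<close> extends the inclusion of \<open>range B\<close> into the Hilbert space by continuity: the
  inclusion is bounded, so a Cauchy sequence of the range space converges in the Hilbert space.
\<close>

definition aux_J :: "('a::complex_hilbert_space \<Rightarrow>\<^sub>L 'a) \<Rightarrow> (nat \<Rightarrow> 'a) set \<Rightarrow> 'a" where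
  "aux_J B X = lim (cip_rep X)"

definition aux_J_adj :: "('a::complex_hilbert_space \<Rightarrow>\<^sub>L 'a) \<Rightarrow> 'a \<Rightarrow> (nat \<Rightarrow> 'a) set" where
  "aux_J_adj B x = (THE k. k \<in> Carr (aux_space B) \<and>
     (\<forall>h\<in>Carr (aux_space B). cinner (aux_J B h) x = Ip (aux_space B) h k))"

end

theory Submission imports Defs begin

text \<open>
  Write \<open>B = A + C\<close> and \<open>A = J\<^sub>B T J\<^sub>B\<^sup>*\<close> with a positive contraction \<open>T\<close> on the auxiliary space
  of \<open>B\<close>. Then \<open>A : C = J\<^sub>B (T - T\<^sup>2) J\<^sub>B\<^sup>*\<close>, and each of the four conditions says that
  \<open>T\<close> is a projection. Since \<open>(A(x - y)|x - y) + (Cy|y)\<close> is the square of the distance of \<open>J\<^sub>B\<^sup>*y\<close>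
  from \<open>T J\<^sub>B\<^sup>*x\<close> when \<open>T\<close> is a projection, this can be stated inside the original space:
  for every \<open>x\<close> there are \<open>y\<^sub>n\<close> with \<open>(A(x - y\<^sub>n)|x - y\<^sub>n) + (Cy\<^sub>n|y\<^sub>n)\<close> tending to \<open>0\<close>. All
  conditions are compared with this one (\<open>splitting\<close>) by estimates in the seminorms of the
  quadratic forms of \<open>A\<close>, \<open>B\<close> and \<open>C\<close>, without square roots of operators.
\<close>

section \<open>Quadratic forms of positive operators\<close>

text \<open>For any positive contraction \<open>T\<close>, reading \<open>x\<close> and
  \<open>y\<close> as their images in the auxiliary space, \<open>(A(x - y)|x - y) + (Cy|y)\<close>
  equals \<open>||y - Tx||^2 + ((T - T^2)x|x)\<close>. The images of \<open>y\<close> are dense, so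
  the infimum over \<open>y\<close> is the second term. This is where the formula for
  \<open>A : C\<close> comes from, and why the infimum vanishes for every \<open>x\<close> exactly
  when \<open>T^2 = T\<close>. The infimum need not be attained in the original space, because
  \<open>Tx\<close> lies in the completion only. Sequences therefore take the place of the
  minimiser. They are Cauchy in a seminorm and may be unbounded in norm, so a pairing of a null
  sequence with such a sequence always needs an argument of its own. \<open>parallel_sum\<close> and
  \<open>generalized_short\<close> are definite descriptions; operators with the right forms must be
  constructed before either can be used.\<close>

lemma cinner_add_right: "cinner x (y + z) = cinner x y + cinner x z"
  by (metis cinner_add_left cinner_commute complex_cnj_add)

lemma cinner_scaleC_right: "cinner x (c *\<^sub>C y) = cnj c * cinner x y"
  by (metis cinner_scaleC_left cinner_commute complex_cnj_mult)

lemma cinner_scaleR_left: "cinner (r *\<^sub>R x) y = of_real r * cinner x y"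
  by (simp add: scaleR_scaleC cinner_scaleC_left)

lemma cinner_scaleR_right: "cinner x (r *\<^sub>R y) = of_real r * cinner x y"
  by (simp add: scaleR_scaleC cinner_scaleC_right)

lemma cinner_minus_left: "cinner (- x) y = - cinner x y"
  using cinner_scaleR_left[of "-1" x y] by simp

lemma cinner_minus_right: "cinner x (- y) = - cinner x y"
  using cinner_scaleR_right[of x "-1" y] by simp

lemma cinner_diff_left: "cinner (x - y) z = cinner x z - cinner y z"
  using cinner_add_left[of x "-y" z] by (simp add: cinner_minus_left)

lemma cinner_diff_right: "cinner x (y - z) = cinner x y - cinner x z"
  using cinner_add_right[of x y "-z"] by (simp add: cinner_minus_right)

lemma cinner_zero_left [simp]: "cinner 0 y = 0"
  using cinner_diff_left[of 0 0 y] by simp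

lemma cinner_zero_right [simp]: "cinner x 0 = 0"
  using cinner_diff_right[of x 0 0] by simp

lemmas cinner_simps = cinner_add_left cinner_add_right cinner_diff_left cinner_diff_right
  cinner_scaleC_left cinner_scaleC_right cinner_scaleR_left cinner_scaleR_right

lemma scaleC_diff_right: "c *\<^sub>C (x - y) = c *\<^sub>C x - c *\<^sub>C y"
  using scaleC_add_right[of c "x - y" y] by (simp add: algebra_simps)

lemma scaleC_minus_one: "(-1) *\<^sub>C x = - x"
  using scaleR_scaleC[of "-1" x] by simp

definition qform :: "('a::complex_hilbert_space \<Rightarrow>\<^sub>L 'a) \<Rightarrow> 'a \<Rightarrow> real" where
  "qform A x = Re (cinner (A x) x)"

text \<open>For positive \<open>A\<close> this is the norm of the square root of \<open>A\<close>
  applied to \<open>x\<close>, and equally the norm of \<open>A x\<close> in the auxiliary space of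
  \<open>A\<close>. It is only a seminorm, since \<open>A\<close> may have a kernel.\<close>

definition qnorm :: "('a::complex_hilbert_space \<Rightarrow>\<^sub>L 'a) \<Rightarrow> 'a \<Rightarrow> real" where
  "qnorm A x = sqrt (qform A x)"

lemma qform_add_op: "qform (A + B) x = qform A x + qform B x"
  by (simp add: qform_def blinfun.add_left cinner_simps)

lemma qform_diff_op: "qform (A - B) x = qform A x - qform B x"
  by (simp add: qform_def blinfun.diff_left cinner_simps)

lemma qform_scaleR_op: "qform (r *\<^sub>R A) x = r * qform A x"
  by (simp add: qform_def blinfun.scaleR_left cinner_simps)

lemma qform_minus [simp]: "qform A (- x) = qform A x"
  by (simp add: qform_def blinfun.minus_right cinner_minus_left cinner_minus_right)

lemma qform_minus_commute: "qform A (x - y) = qform A (y - x)"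
  by (metis qform_minus minus_diff_eq)

lemma qnorm_minus_commute: "qnorm A (x - y) = qnorm A (y - x)"
  by (simp add: qnorm_def qform_minus_commute)

lemma qform_zero [simp]: "qform A 0 = 0"
  by (simp add: qform_def)

lemma qform_parallelogram:
  "qform A (x + y) + qform A (x - y) = 2 * qform A x + 2 * qform A y"
  by (simp add: qform_def blinfun.add_right blinfun.diff_right cinner_simps)

lemma positive_op_add: "positive_op A \<Longrightarrow> positive_op B \<Longrightarrow> positive_op (A + B)"
  using positive_op_convex_comb[of A B 1 1] by simp

lemma positive_op_scaleR: "positive_op A \<Longrightarrow> 0 \<le> r \<Longrightarrow> positive_op (r *\<^sub>R A)"
  using positive_op_convex_comb[of A A r 0] by simp

lemma positive_op_zero: "positive_op 0"
  using scaleC_diff_right[of _ 0 "0::'a"] by (simp add: positive_op_def complex_linear_op_def)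

lemma positive_op_id: "positive_op id_blinfun"
proof -
  have "cinner x x \<in> \<real>\<^sub>\<ge>\<^sub>0" for x :: 'a
    unfolding complex_nonneg_Reals_iff
  proof
    show "0 \<le> Re (cinner x x)" using inner_ge_zero[of x] by (simp only: inner_cinner)
    have "Im (cinner x x) = - Im (cinner x x)" by (metis cinner_commute cnj.sel(2))
    then show "Im (cinner x x) = 0" by linarith
  qed
  then show ?thesis by (simp add: positive_op_def complex_linear_op_def)
qed

lemma cinner_positive_op: "positive_op A \<Longrightarrow> cinner (A x) x = of_real (qform A x)"
  by (auto simp: positive_op_def qform_def complex_nonneg_Reals_iff complex_eq_iff)

lemma qform_nonneg [simp]: "positive_op A \<Longrightarrow> 0 \<le> qform A x"
  by (auto simp: positive_op_def qform_def complex_nonneg_Reals_iff)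

lemma qnorm_nonneg [simp]: "positive_op A \<Longrightarrow> 0 \<le> qnorm A x"
  by (simp add: qnorm_def)

lemma qnorm_power2: "positive_op A \<Longrightarrow> (qnorm A x)\<^sup>2 = qform A x"
  by (simp add: qnorm_def)

lemma positive_op_scaleC: "positive_op A \<Longrightarrow> A (c *\<^sub>C x) = c *\<^sub>C A x"
  by (simp add: positive_op_def complex_linear_op_def)

text \<open>Polarisation: the form is real at \<open>x + y\<close>, which settles the imaginary part
  of the symmetry; replacing \<open>x\<close> by \<open>\<i> *\<^sub>C x\<close> turns the same fact
  into the statement on real parts.\<close>

lemma positive_op_selfadjoint:
  assumes "positive_op A"
  shows "cinner (A x) y = cinner x (A y)"
proof -
  have im: "Im (cinner (A z) z) = 0" for z
    using cinner_positive_op[OF assms] by simp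
  have *: "Im (cinner (A x) y + cinner (A y) x) = 0" for x y
    using im[of "x + y"] im[of x] im[of y] by (simp add: blinfun.add_right cinner_simps)
  have "Re (cinner (A x) y) = Re (cinner (A y) x)"
    using *[of "\<i> *\<^sub>C x" y] by (simp add: positive_op_scaleC[OF assms] cinner_simps)
  moreover have "Im (cinner (A x) y) = - Im (cinner (A y) x)"
    using *[of x y] by simp
  ultimately have "cinner (A x) y = cnj (cinner (A y) x)"
    by (simp add: complex_eq_iff)
  then show ?thesis using cinner_commute[of x "A y"] by simp
qed

lemma Re_positive_op_commute:
  "positive_op A \<Longrightarrow> Re (cinner (A x) y) = Re (cinner (A y) x)"
  by (metis positive_op_selfadjoint cinner_commute cnj.sel(1))

lemma qform_add:
  "positive_op A \<Longrightarrow> qform A (x + y) = qform A x + 2 * Re (cinner (A x) y) + qform A y"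
  using Re_positive_op_commute[of A x y]
  by (simp add: qform_def blinfun.add_right cinner_simps)

lemma qform_diff:
  "positive_op A \<Longrightarrow> qform A (x - y) = qform A x - 2 * Re (cinner (A x) y) + qform A y"
  using Re_positive_op_commute[of A x y]
  by (simp add: qform_def blinfun.diff_right cinner_simps)

lemma qform_scaleC: "positive_op A \<Longrightarrow> qform A (c *\<^sub>C x) = (cmod c)\<^sup>2 * qform A x"
proof -
  assume A: "positive_op A"
  have "cinner (A (c *\<^sub>C x)) (c *\<^sub>C x) = (c * cnj c) * cinner (A x) x"
    by (simp add: positive_op_scaleC[OF A] cinner_simps)
  then show ?thesis
    by (simp add: qform_def complex_norm_square[symmetric] del: of_real_power)
qed

lemma qform_scaleR: "qform A (r *\<^sub>R x) = r\<^sup>2 * qform A x"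
  by (simp add: qform_def blinfun.scaleR_right cinner_simps power2_eq_square)

lemma qnorm_scaleC: "positive_op A \<Longrightarrow> qnorm A (c *\<^sub>C x) = cmod c * qnorm A x"
  by (simp add: qnorm_def qform_scaleC real_sqrt_mult)

section \<open>The Cauchy-Schwarz inequality and the seminorm of a positive operator\<close>

lemma quadratic_nonneg_imp_discriminant:
  fixes a b c :: real
  assumes "\<And>t. 0 \<le> a + 2 * t * b + t\<^sup>2 * c" and "0 \<le> c"
  shows "b\<^sup>2 \<le> a * c"
proof (cases "c = 0")
  case True
  show ?thesis
  proof (cases "b = 0")
    case False
    \<comment> \<open>With \<open>c = 0\<close> the polynomial is affine in \<open>t\<close>, and at
      this \<open>t\<close> it equals -1.\<close>
    then show ?thesis using assms(1)[of "- (a + 1) / (2 * b)"] True by (simp add: field_simps)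
  qed (use True in simp)
next
  case False
  then have "0 < c" using assms(2) by simp
  have "a + 2 * (- b / c) * b + (- b / c)\<^sup>2 * c = a - b\<^sup>2 / c"
    using False by (simp add: field_simps power2_eq_square)
  then have "b\<^sup>2 / c \<le> a" using assms(1)[of "- b / c"] by simp
  then show ?thesis using \<open>0 < c\<close> by (simp add: field_simps)
qed

text \<open>The discriminant in a real parameter bounds only the real part of the product.
  Multiplying \<open>x\<close> by a unimodular \<open>c\<close> that makes the product real and
  nonnegative gives the modulus.\<close>

lemma positive_op_Cauchy_Schwarz:
  assumes A: "positive_op A"
  shows "cmod (cinner (A x) y) \<le> qnorm A x * qnorm A y"
proof -
  have re: "Re (cinner (A x) y) \<le> qnorm A x * qnorm A y" for x
  proof -
    have "0 \<le> qform A x + 2 * t * Re (cinner (A x) y) + t\<^sup>2 * qform A y" for t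
      using qform_nonneg[OF A, of "x + t *\<^sub>R y"]
      by (simp add: qform_add[OF A] qform_scaleR cinner_simps algebra_simps)
    then have "(Re (cinner (A x) y))\<^sup>2 \<le> qform A x * qform A y"
      using quadratic_nonneg_imp_discriminant A by simp
    then have "\<bar>Re (cinner (A x) y)\<bar> \<le> qnorm A x * qnorm A y"
      by (simp add: qnorm_def real_sqrt_mult[symmetric] real_le_rsqrt)
    then show ?thesis by simp
  qed
  obtain c where c: "cmod c = 1" "c * cinner (A x) y = of_real (cmod (cinner (A x) y))"
  proof (cases "cinner (A x) y = 0")
    case False
    let ?z = "cinner (A x) y"
    show ?thesis
    proof (rule that[of "of_real (cmod ?z) / ?z"])
      show "cmod (of_real (cmod ?z) / ?z) = 1" using False by (simp add: norm_divide)
    qed (use False in simp)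
  qed (use that[of 1] in simp)
  have "cmod (cinner (A x) y) = Re (cinner (A (c *\<^sub>C x)) y)"
    using c(2) by (simp add: positive_op_scaleC[OF A] cinner_simps)
  also have "\<dots> \<le> qnorm A (c *\<^sub>C x) * qnorm A y" by (rule re)
  finally show ?thesis using c(1) by (simp add: qnorm_scaleC[OF A])
qed

lemma qnorm_triangle:
  assumes A: "positive_op A"
  shows "qnorm A (x + y) \<le> qnorm A x + qnorm A y"
proof (rule power2_le_imp_le)
  have "Re (cinner (A x) y) \<le> qnorm A x * qnorm A y"
    using positive_op_Cauchy_Schwarz[OF A] complex_Re_le_cmod order_trans by blast
  then show "(qnorm A (x + y))\<^sup>2 \<le> (qnorm A x + qnorm A y)\<^sup>2"
    by (simp add: qnorm_power2[OF A] qform_add[OF A] power2_sum)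
qed (use A in simp)

lemma qnorm_triangle_diff:
  "positive_op A \<Longrightarrow> qnorm A (x - z) \<le> qnorm A (x - y) + qnorm A (y - z)"
  using qnorm_triangle[of A "x - y" "y - z"] by simp

lemma qnorm_diff_le: "positive_op A \<Longrightarrow> qnorm A (x - y) \<le> qnorm A x + qnorm A y"
  using qnorm_triangle_diff[of A x y 0] by (simp add: qnorm_def)

lemma qnorm_reverse_triangle:
  "positive_op A \<Longrightarrow> \<bar>qnorm A x - qnorm A y\<bar> \<le> qnorm A (x - y)"
  using qnorm_triangle[of A "x - y" y] qnorm_triangle[of A "y - x" x]
  by (simp add: qnorm_minus_commute[of A y x])

lemma cmod_cinner_le: "cmod (cinner x y) \<le> norm x * norm y"
  using positive_op_Cauchy_Schwarz[OF positive_op_id, of x y]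
  by (simp add: qnorm_def qform_def inner_cinner[symmetric] norm_eq_sqrt_inner)

lemma bounded_bilinear_cinner: "bounded_bilinear cinner"
  by standard (auto simp: cinner_simps scaleR_conv_of_real intro!: exI[of _ 1] cmod_cinner_le)

lemmas tendsto_cinner [tendsto_intros] = bounded_bilinear.tendsto[OF bounded_bilinear_cinner]

section \<open>Norm bounds and the order of positive operators\<close>

lemma qform_le_norm: "qform A x \<le> norm A * (norm x)\<^sup>2"
proof -
  have "qform A x \<le> norm (A x) * norm x"
    using complex_Re_le_cmod cmod_cinner_le order_trans unfolding qform_def by blast
  also have "\<dots> \<le> norm A * norm x * norm x"
    by (intro mult_right_mono norm_blinfun) simp
  finally show ?thesis by (simp add: power2_eq_square mult.assoc)
qed

lemma qnorm_le_norm: "qnorm A x \<le> sqrt (norm A) * norm x"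
  using real_sqrt_le_mono[OF qform_le_norm[of A x]] by (simp add: qnorm_def real_sqrt_mult)

text \<open>Cauchy-Schwarz for the vectors \<open>x\<close> and \<open>A x\<close>. For
  \<open>B = A\<close> this is the boundedness of the inclusion of the auxiliary space; a dominating
  \<open>B\<close> gives a constant that is the same for a whole family of operators below
  it.\<close>

lemma norm_positive_op_le:
  assumes A: "positive_op A" and le: "\<And>x. qform A x \<le> qform B x"
  shows "norm (A x) \<le> sqrt (norm B) * qnorm A x"
proof (cases "A x = 0")
  case False
  have "(norm (A x))\<^sup>2 = Re (cinner (A x) (A x))"
    by (simp add: power2_norm_eq_inner inner_cinner)
  also have "\<dots> \<le> qnorm A x * qnorm A (A x)"
    using positive_op_Cauchy_Schwarz[OF A] complex_Re_le_cmod order_trans by blast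
  also have "\<dots> \<le> qnorm A x * qnorm B (A x)"
    using A le by (intro mult_left_mono) (auto simp: qnorm_def)
  also have "\<dots> \<le> qnorm A x * (sqrt (norm B) * norm (A x))"
    using A by (intro mult_left_mono qnorm_le_norm) simp
  finally have "norm (A x) * norm (A x) \<le> (sqrt (norm B) * qnorm A x) * norm (A x)"
    by (simp add: power2_eq_square mult_ac)
  then show ?thesis using False by simp
qed (use A in simp)

lemma op_le_iff_qform:
  assumes "positive_op A" "positive_op B"
  shows "A \<preceq> B \<longleftrightarrow> (\<forall>x. qform A x \<le> qform B x)"
proof
  assume "A \<preceq> B"
  then show "\<forall>x. qform A x \<le> qform B x"
    using qform_nonneg by (fastforce simp: op_le_def qform_diff_op)
next
  assume le: "\<forall>x. qform A x \<le> qform B x"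
  have "cinner ((B - A) x) x = of_real (qform B x - qform A x)" for x
    using assms by (simp add: blinfun.diff_left cinner_simps cinner_positive_op)
  then show "A \<preceq> B" using assms le
    by (auto simp: op_le_def positive_op_def complex_linear_op_def blinfun.diff_left
        scaleC_diff_right simp del: of_real_diff)
qed

text \<open>The difference is positive with vanishing seminorm, and
  \<open>norm_positive_op_le\<close> bounds its values by that seminorm.\<close>

lemma positive_op_eqI:
  assumes A: "positive_op A" and B: "positive_op B" and eq: "\<And>x. qform A x = qform B x"
  shows "A = B"
proof (rule blinfun_eqI)
  fix x
  have "positive_op (B - A)"
    using op_le_iff_qform[OF A B] eq by (simp add: op_le_def)
  then have "norm ((B - A) x) \<le> sqrt (norm (B - A)) * qnorm (B - A) x"
    by (rule norm_positive_op_le) simp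
  then show "A x = B x" by (simp add: qnorm_def qform_diff_op eq blinfun.diff_left)
qed

text \<open>Continuity of complex scaling is not a class axiom. The homogeneity of the norm is read
  off from the seminorm of the identity operator.\<close>

lemma tendsto_scaleC:
  assumes "x \<longlonglongrightarrow> (l::'a::complex_hilbert_space)"
  shows "(\<lambda>n. c *\<^sub>C x n) \<longlonglongrightarrow> c *\<^sub>C l"
proof (rule LIM_zero_cancel, rule tendsto_norm_zero_cancel)
  have "norm (c *\<^sub>C z) = cmod c * norm z" for z :: 'a
  proof -
    have "qnorm id_blinfun u = norm u" for u :: 'a
      by (simp add: qnorm_def qform_def inner_cinner[symmetric] norm_eq_sqrt_inner)
    then show ?thesis using qnorm_scaleC[OF positive_op_id, of c z] by simp
  qed
  then have "norm (c *\<^sub>C x n - c *\<^sub>C l) = cmod c * norm (x n - l)" for n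
    by (simp add: scaleC_diff_right[symmetric])
  then show "(\<lambda>n. norm (c *\<^sub>C x n - c *\<^sub>C l)) \<longlonglongrightarrow> 0"
    using tendsto_mult_left[OF tendsto_norm_zero[OF LIM_zero[OF assms]], of "cmod c"] by simp
qed

section \<open>Preimages of Cauchy sequences in the auxiliary inner product\<close>

definition qCauchy :: "('a::complex_hilbert_space \<Rightarrow>\<^sub>L 'a) \<Rightarrow> (nat \<Rightarrow> 'a) \<Rightarrow> bool" where
  "qCauchy A x \<longleftrightarrow> (\<forall>e>0. \<exists>N. \<forall>m\<ge>N. \<forall>n\<ge>N. qnorm A (x m - x n) < e)"

lemma qCauchy_const: "qCauchy A (\<lambda>n. x)"
  by (simp add: qCauchy_def qnorm_def)

lemma qCauchy_qnorm_convergent: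
  assumes A: "positive_op A" and x: "qCauchy A x"
  shows "convergent (\<lambda>n. qnorm A (x n))"
proof (rule Cauchy_convergent, rule CauchyI)
  fix e :: real assume "0 < e"
  then obtain N where "\<forall>m\<ge>N. \<forall>n\<ge>N. qnorm A (x m - x n) < e"
    using x by (auto simp: qCauchy_def)
  then show "\<exists>N. \<forall>m\<ge>N. \<forall>n\<ge>N. norm (qnorm A (x m) - qnorm A (x n)) < e"
    using le_less_trans[OF qnorm_reverse_triangle[OF A]] unfolding real_norm_def by meson
qed

lemma qCauchy_bounded:
  assumes A: "positive_op A" and x: "qCauchy A x"
  obtains K where "0 < K" "\<And>n. qnorm A (x n) \<le> K"
proof -
  obtain K where "0 < K" and K: "\<And>n. norm (qnorm A (x n)) \<le> K"
    using BseqE[OF convergent_imp_Bseq[OF qCauchy_qnorm_convergent[OF A x]]] by metis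
  then show thesis using K A by (intro that[of K]) simp_all
qed

lemma qCauchy_add:
  assumes A: "positive_op A" and x: "qCauchy A x" and y: "qCauchy A y"
  shows "qCauchy A (\<lambda>n. x n + y n)"
  unfolding qCauchy_def
proof (intro allI impI)
  fix e :: real assume "0 < e"
  then obtain M N where M: "\<forall>m\<ge>M. \<forall>n\<ge>M. qnorm A (x m - x n) < e / 2"
    and N: "\<forall>m\<ge>N. \<forall>n\<ge>N. qnorm A (y m - y n) < e / 2"
    using x y half_gt_zero unfolding qCauchy_def by metis
  have "qnorm A (x m + y m - (x n + y n)) < e" if "m \<ge> max M N" "n \<ge> max M N" for m n
  proof -
    have "qnorm A (x m + y m - (x n + y n)) \<le> qnorm A (x m - x n) + qnorm A (y m - y n)"
      using qnorm_triangle[OF A, of "x m - x n" "y m - y n"] by (simp add: algebra_simps)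
    also have "\<dots> < e / 2 + e / 2" using M N that by (intro add_strict_mono) auto
    finally show ?thesis by simp
  qed
  then show "\<exists>N. \<forall>m\<ge>N. \<forall>n\<ge>N. qnorm A (x m + y m - (x n + y n)) < e" by blast
qed

lemma qCauchy_scaleC:
  assumes A: "positive_op A" and x: "qCauchy A x"
  shows "qCauchy A (\<lambda>n. c *\<^sub>C x n)"
  unfolding qCauchy_def
proof (intro allI impI)
  fix e :: real assume "0 < e"
  then have "0 < e / (cmod c + 1)" by (simp add: add_nonneg_pos)
  then obtain N where N: "\<forall>m\<ge>N. \<forall>n\<ge>N. qnorm A (x m - x n) < e / (cmod c + 1)"
    using x unfolding qCauchy_def by blast
  have "qnorm A (c *\<^sub>C x m - c *\<^sub>C x n) < e" if "m \<ge> N" "n \<ge> N" for m n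
  proof -
    have "qnorm A (c *\<^sub>C x m - c *\<^sub>C x n) = cmod c * qnorm A (x m - x n)"
      by (simp add: scaleC_diff_right[symmetric] qnorm_scaleC[OF A])
    also have "\<dots> \<le> (cmod c + 1) * qnorm A (x m - x n)"
      using A by (intro mult_right_mono) auto
    also have "\<dots> < e"
      using N that by (simp add: pos_less_divide_eq add_nonneg_pos mult.commute)
    finally show ?thesis .
  qed
  then show "\<exists>N. \<forall>m\<ge>N. \<forall>n\<ge>N. qnorm A (c *\<^sub>C x m - c *\<^sub>C x n) < e" by blast
qed

lemma qCauchy_image_convergent:
  assumes A: "positive_op A" and x: "qCauchy A x"
  shows "convergent (\<lambda>n. A (x n))"
proof (rule Cauchy_convergent, rule CauchyI)
  fix e :: real assume "0 < e"
  define K where "K = sqrt (norm A) + 1"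
  have K: "0 < K" by (simp add: K_def add_nonneg_pos)
  then obtain N where N: "\<forall>m\<ge>N. \<forall>n\<ge>N. qnorm A (x m - x n) < e / K"
    using x \<open>0 < e\<close> unfolding qCauchy_def by (meson divide_pos_pos)
  have "norm (A (x m) - A (x n)) < e" if "m \<ge> N" "n \<ge> N" for m n
  proof -
    have "norm (A (x m) - A (x n)) \<le> sqrt (norm A) * qnorm A (x m - x n)"
      using norm_positive_op_le[OF A, of A "x m - x n"] by (simp add: blinfun.diff_right)
    also have "\<dots> \<le> K * qnorm A (x m - x n)"
      using A by (intro mult_right_mono) (auto simp: K_def)
    also have "\<dots> < e" using N that K by (simp add: pos_less_divide_eq mult.commute)
    finally show ?thesis .
  qed
  then show "\<exists>N. \<forall>m\<ge>N. \<forall>n\<ge>N. norm (A (x m) - A (x n)) < e" by blast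
qed

lemma tendsto_qform_zero_iff:
  assumes "positive_op A"
  shows "(\<lambda>n. qform A (x n)) \<longlonglongrightarrow> 0 \<longleftrightarrow> (\<lambda>n. qnorm A (x n)) \<longlonglongrightarrow> 0"
  using tendsto_real_sqrt[of "\<lambda>n. qform A (x n)" 0 sequentially]
    tendsto_power[of "\<lambda>n. qnorm A (x n)" 0 sequentially 2]
  by (auto simp: qnorm_power2[OF assms] qnorm_def[symmetric])

lemma qnorm_null_image:
  assumes A: "positive_op A" and x: "(\<lambda>n. qnorm A (x n)) \<longlonglongrightarrow> 0"
  shows "(\<lambda>n. A (x n)) \<longlonglongrightarrow> 0"
proof (rule tendsto_norm_zero_cancel, rule tendsto_sandwich[of "\<lambda>_. 0"])
  show "(\<lambda>n. sqrt (norm A) * qnorm A (x n)) \<longlonglongrightarrow> 0"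
    using tendsto_mult_left[OF x, of "sqrt (norm A)"] by simp
  show "\<forall>\<^sub>F n in sequentially. norm (A (x n)) \<le> sqrt (norm A) * qnorm A (x n)"
    using norm_positive_op_le[OF A] by simp
qed auto

text \<open>In the completion of \<open>range A\<close> the sequence converges to a vector with image \<open>u\<close>;
  this is how that convergence is expressed without the completion.\<close>

lemma qCauchy_residual_tendsto:
  assumes A: "positive_op A" and x: "qCauchy A x" and u: "(\<lambda>n. A (x n)) \<longlonglongrightarrow> u"
  shows "(\<lambda>n. cinner (u - A (x n)) (x n)) \<longlonglongrightarrow> 0"
proof (rule LIMSEQ_I)
  fix e :: real assume "0 < e"
  obtain K where K: "0 < K" "\<And>n. qnorm A (x n) \<le> K" using qCauchy_bounded[OF A x] by blast
  then obtain N where N: "\<forall>m\<ge>N. \<forall>n\<ge>N. qnorm A (x m - x n) < e / (2 * K)"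
    using x \<open>0 < e\<close> unfolding qCauchy_def by (meson divide_pos_pos mult_pos_pos zero_less_numeral)
  \<comment> \<open>With \<open>n\<close> fixed, \<open>m\<close> tends to infinity in the
    Cauchy-Schwarz estimate for \<open>x m - x n\<close> against \<open>x n\<close>. The bound
    \<open>K\<close> on the seminorms stands in for a bound on the norms of
    \<open>x n\<close>.\<close>
  have "cmod (cinner (u - A (x n)) (x n)) \<le> e / 2" if "n \<ge> N" for n
  proof (rule LIMSEQ_le_const2)
    show "(\<lambda>m. cmod (cinner (A (x m) - A (x n)) (x n))) \<longlonglongrightarrow> cmod (cinner (u - A (x n)) (x n))"
      by (intro tendsto_intros u)
    have "cmod (cinner (A (x m) - A (x n)) (x n)) \<le> e / 2" if "m \<ge> N" for m
    proof -
      have "cmod (cinner (A (x m) - A (x n)) (x n)) \<le> qnorm A (x m - x n) * qnorm A (x n)"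
        using positive_op_Cauchy_Schwarz[OF A, of "x m - x n" "x n"] by (simp add: blinfun.diff_right)
      also have "\<dots> \<le> e / (2 * K) * K"
        using N \<open>n \<ge> N\<close> that K A \<open>0 < e\<close> by (intro mult_mono) (auto intro: less_imp_le)
      finally show ?thesis using K by simp
    qed
    then show "\<exists>M. \<forall>m\<ge>M. cmod (cinner (A (x m) - A (x n)) (x n)) \<le> e / 2" by blast
  qed
  then show "\<exists>N. \<forall>n\<ge>N. cmod (cinner (u - A (x n)) (x n) - 0) < e"
    using \<open>0 < e\<close> by (intro exI[of _ N]) fastforce
qed

text \<open>This is the injectivity of the map from the auxiliary space into the Hilbert space. For
  \<open>u = 0\<close> the residual pairing is minus the quadratic form.\<close>

lemma qCauchy_null:
  assumes A: "positive_op A" and x: "qCauchy A x" and 0: "(\<lambda>n. A (x n)) \<longlonglongrightarrow> 0"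
  shows "(\<lambda>n. qnorm A (x n)) \<longlonglongrightarrow> 0"
proof -
  have "(\<lambda>n. - Re (cinner (0 - A (x n)) (x n))) \<longlonglongrightarrow> 0"
    using tendsto_minus[OF tendsto_Re[OF qCauchy_residual_tendsto[OF A x 0]]] by simp
  then have "(\<lambda>n. qform A (x n)) \<longlonglongrightarrow> 0"
    by (simp add: cinner_minus_left qform_def)
  then show ?thesis by (simp add: tendsto_qform_zero_iff[OF A])
qed

section \<open>Parallel sums\<close>

text \<open>\<open>par_rel A B x w\<close> says that \<open>w\<close> is the value of \<open>A : B\<close> at \<open>x\<close>: the
  sequence \<open>y\<close> minimises \<open>(A(x - y)|x - y) + (By|y)\<close>, and the two limits agree because the
  derivative of this functional vanishes at the minimum.\<close>

definition par_rel ::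
    "('a::complex_hilbert_space \<Rightarrow>\<^sub>L 'a) \<Rightarrow> ('a \<Rightarrow>\<^sub>L 'a) \<Rightarrow> 'a \<Rightarrow> 'a \<Rightarrow> bool" where
  "par_rel A B x w \<longleftrightarrow> (\<exists>y. qCauchy (A + B) y \<and>
     (\<lambda>n. A (x - y n)) \<longlonglongrightarrow> w \<and> (\<lambda>n. B (y n)) \<longlonglongrightarrow> w)"

lemma par_rel_add:
  assumes "positive_op A" "positive_op B" "par_rel A B x w" "par_rel A B x' w'"
  shows "par_rel A B (x + x') (w + w')"
proof -
  obtain y y' where y: "qCauchy (A + B) y" "(\<lambda>n. A (x - y n)) \<longlonglongrightarrow> w" "(\<lambda>n. B (y n)) \<longlonglongrightarrow> w"
    and y': "qCauchy (A + B) y'" "(\<lambda>n. A (x' - y' n)) \<longlonglongrightarrow> w'" "(\<lambda>n. B (y' n)) \<longlonglongrightarrow> w'"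
    using assms(3,4) unfolding par_rel_def by blast
  show ?thesis unfolding par_rel_def
  proof (intro exI[of _ "\<lambda>n. y n + y' n"] conjI)
    show "qCauchy (A + B) (\<lambda>n. y n + y' n)"
      by (intro qCauchy_add positive_op_add assms(1,2) y(1) y'(1))
    show "(\<lambda>n. A (x + x' - (y n + y' n))) \<longlonglongrightarrow> w + w'"
      using tendsto_add[OF y(2) y'(2)] by (simp add: blinfun.add_right[symmetric] algebra_simps)
    show "(\<lambda>n. B (y n + y' n)) \<longlonglongrightarrow> w + w'"
      using tendsto_add[OF y(3) y'(3)] by (simp add: blinfun.add_right)
  qed
qed

lemma par_rel_scaleC:
  assumes "positive_op A" "positive_op B" "par_rel A B x w"
  shows "par_rel A B (c *\<^sub>C x) (c *\<^sub>C w)"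
proof -
  obtain y where y: "qCauchy (A + B) y" "(\<lambda>n. A (x - y n)) \<longlonglongrightarrow> w" "(\<lambda>n. B (y n)) \<longlonglongrightarrow> w"
    using assms(3) unfolding par_rel_def by blast
  show ?thesis unfolding par_rel_def
  proof (intro exI[of _ "\<lambda>n. c *\<^sub>C y n"] conjI)
    show "qCauchy (A + B) (\<lambda>n. c *\<^sub>C y n)"
      by (intro qCauchy_scaleC positive_op_add assms(1,2) y(1))
    show "(\<lambda>n. A (c *\<^sub>C x - c *\<^sub>C y n)) \<longlonglongrightarrow> c *\<^sub>C w"
      using tendsto_scaleC[OF y(2), of c]
      by (simp add: positive_op_scaleC[OF assms(1)] scaleC_diff_right[symmetric])
    show "(\<lambda>n. B (c *\<^sub>C y n)) \<longlonglongrightarrow> c *\<^sub>C w"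
      using tendsto_scaleC[OF y(3), of c] by (simp add: positive_op_scaleC[OF assms(2)])
  qed
qed

text \<open>By linearity the difference of two values belongs to \<open>x = 0\<close>. There
  \<open>(A + B) (y n)\<close> tends to 0, so \<open>y\<close> is null in the seminorm of
  \<open>A + B\<close>, hence in that of \<open>B\<close>, and \<open>B (y n)\<close> tends to
  0.\<close>

lemma par_rel_unique:
  assumes A: "positive_op A" and B: "positive_op B"
    and "par_rel A B x w" "par_rel A B x w'"
  shows "w = w'"
proof -
  have "par_rel A B (x + (-1) *\<^sub>C x) (w + (-1) *\<^sub>C w')"
    by (intro par_rel_add par_rel_scaleC assms)
  then obtain y where y: "qCauchy (A + B) y" "(\<lambda>n. A (0 - y n)) \<longlonglongrightarrow> w - w'"
      "(\<lambda>n. B (y n)) \<longlonglongrightarrow> w - w'"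
    unfolding par_rel_def by (auto simp: scaleC_minus_one)
  have "(\<lambda>n. (A + B) (y n)) \<longlonglongrightarrow> 0"
    using tendsto_diff[OF y(3) y(2)] by (simp add: blinfun.add_left blinfun.diff_right blinfun.minus_right add.commute)
  then have "(\<lambda>n. qnorm (A + B) (y n)) \<longlonglongrightarrow> 0"
    by (intro qCauchy_null positive_op_add A B y(1))
  then have "(\<lambda>n. qnorm B (y n)) \<longlonglongrightarrow> 0"
  proof (rule tendsto_sandwich[of "\<lambda>_. 0", rotated 3])
    show "\<forall>\<^sub>F n in sequentially. qnorm B (y n) \<le> qnorm (A + B) (y n)"
      by (simp add: A qnorm_def qform_add_op)
  qed (simp_all add: B)
  then have "(\<lambda>n. B (y n)) \<longlonglongrightarrow> 0" by (rule qnorm_null_image[OF B])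
  then have "w - w' = 0" by (rule LIMSEQ_unique[OF y(3)])
  then show ?thesis by simp
qed

text \<open>The residual \<open>E n\<close> is minus half the gradient of the functional at
  \<open>y n\<close>. Around \<open>y n\<close> the functional is its value there, a linear term in
  \<open>E n\<close> that disappears in the limit, and a nonnegative quadratic term; so no
  \<open>z\<close> falls below the limit.\<close>

lemma par_rel_qform:
  assumes A: "positive_op A" and B: "positive_op B" and w: "par_rel A B x w"
  obtains y where "(\<lambda>n. A (x - y n)) \<longlonglongrightarrow> w"
    and "(\<lambda>n. qform A (x - y n) + qform B (y n)) \<longlonglongrightarrow> Re (cinner w x)"
    and "cinner w x \<in> \<real>\<^sub>\<ge>\<^sub>0"
    and "\<And>z. Re (cinner w x) \<le> qform A (x - z) + qform B z"
proof -
  obtain y where y: "qCauchy (A + B) y" "(\<lambda>n. A (x - y n)) \<longlonglongrightarrow> w" "(\<lambda>n. B (y n)) \<longlonglongrightarrow> w"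
    using w unfolding par_rel_def by blast
  define E where "E n = A x - (A + B) (y n)" for n
  have E: "E n = A (x - y n) - B (y n)" for n
    by (simp add: E_def blinfun.add_left blinfun.diff_right)
  have "(\<lambda>n. (A + B) (y n)) \<longlonglongrightarrow> A x - w + w"
    using tendsto_add[OF tendsto_diff[OF tendsto_const y(2)] y(3), of "A x"]
    by (simp add: blinfun.add_left blinfun.diff_right)
  \<comment> \<open>\<open>y n\<close> may be unbounded in norm, so \<open>E\<close> tending to 0
    would not suffice; the Cauchy property in the seminorm does it.\<close>
  then have Ey: "(\<lambda>n. cinner (E n) (y n)) \<longlonglongrightarrow> 0"
    unfolding E_def by (intro qCauchy_residual_tendsto positive_op_add A B y(1)) simp
  have E0: "E \<longlonglongrightarrow> 0"
    using tendsto_diff[OF y(2,3)] by (simp add: E[abs_def])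
  have "complex_of_real (qform A (x - y n) + qform B (y n))
      = cinner (A (x - y n)) x - cinner (E n) (y n)" for n
    by (simp add: cinner_positive_op[OF A, symmetric] cinner_positive_op[OF B, symmetric]
        E cinner_simps)
  moreover have "(\<lambda>n. cinner (A (x - y n)) x - cinner (E n) (y n)) \<longlonglongrightarrow> cinner w x - 0"
    by (intro tendsto_intros y Ey)
  ultimately have lim: "(\<lambda>n. complex_of_real (qform A (x - y n) + qform B (y n))) \<longlonglongrightarrow> cinner w x"
    by simp
  have lim': "(\<lambda>n. qform A (x - y n) + qform B (y n)) \<longlonglongrightarrow> Re (cinner w x)"
    using tendsto_Re[OF lim] by simp
  show thesis
  proof (rule that[OF y(2) lim'])
    show "cinner w x \<in> \<real>\<^sub>\<ge>\<^sub>0"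
      using A B by (intro closed_sequentially[OF closed_nonneg_Reals_complex _ lim]) auto
    show "Re (cinner w x) \<le> qform A (x - z) + qform B z" for z
    proof (rule LIMSEQ_le_const2)
      show "(\<lambda>n. qform A (x - y n) + qform B (y n) - 2 * Re (cinner (E n) z - cinner (E n) (y n)))
          \<longlonglongrightarrow> Re (cinner w x)"
        using tendsto_diff[OF lim' tendsto_mult_left[OF tendsto_Re[OF tendsto_diff[OF
              tendsto_cinner[OF E0 tendsto_const[of z]] Ey]]], of 2] by simp
      have "qform A (x - y n) + qform B (y n) - 2 * Re (cinner (E n) z - cinner (E n) (y n))
          \<le> qform A (x - z) + qform B z" for n
      proof -
        define h where "h = z - y n"
        have "qform A (x - y n - h) + qform B (y n + h) = qform A (x - y n) + qform B (y n)
            - 2 * Re (cinner (E n) h) + qform A h + qform B h"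
          by (simp add: qform_diff[OF A, of "x - y n"] qform_add[OF B] E cinner_simps)
        then show ?thesis using qform_nonneg[OF A, of h] qform_nonneg[OF B, of h]
          by (simp add: h_def cinner_simps)
      qed
      then show "\<exists>N. \<forall>n\<ge>N. qform A (x - y n) + qform B (y n)
          - 2 * Re (cinner (E n) z - cinner (E n) (y n)) \<le> qform A (x - z) + qform B z" by blast
    qed
  qed
qed

lemma sqrt_norm_qnorm_le: "sqrt (norm A) * qnorm A x \<le> norm x * norm A"
proof -
  have "sqrt (norm A) * qnorm A x \<le> sqrt (norm A) * (sqrt (norm A) * norm x)"
    by (intro mult_left_mono qnorm_le_norm) simp
  also have "\<dots> = (sqrt (norm A))\<^sup>2 * norm x"
    by (simp only: power2_eq_square mult.assoc)
  finally show ?thesis by (simp add: mult.commute)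
qed

lemma par_rel_norm_le:
  assumes A: "positive_op A" and B: "positive_op B" and w: "par_rel A B x w"
  shows "norm w \<le> norm x * norm A"
proof -
  obtain y where y: "(\<lambda>n. A (x - y n)) \<longlonglongrightarrow> w"
      "(\<lambda>n. qform A (x - y n) + qform B (y n)) \<longlonglongrightarrow> Re (cinner w x)"
      "\<And>z. Re (cinner w x) \<le> qform A (x - z) + qform B z"
    using par_rel_qform[OF assms] by metis
  have "norm w \<le> sqrt (norm A) * sqrt (Re (cinner w x))"
  proof (rule LIMSEQ_le)
    show "(\<lambda>n. norm (A (x - y n))) \<longlonglongrightarrow> norm w" by (intro tendsto_norm y)
    show "(\<lambda>n. sqrt (norm A) * sqrt (qform A (x - y n) + qform B (y n)))
        \<longlonglongrightarrow> sqrt (norm A) * sqrt (Re (cinner w x))"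
      by (intro tendsto_intros y)
    have "norm (A (x - y n)) \<le> sqrt (norm A) * sqrt (qform A (x - y n) + qform B (y n))" for n
    proof -
      have "norm (A (x - y n)) \<le> sqrt (norm A) * qnorm A (x - y n)"
        by (rule norm_positive_op_le[OF A]) simp
      also have "\<dots> \<le> sqrt (norm A) * sqrt (qform A (x - y n) + qform B (y n))"
        by (intro mult_left_mono) (simp_all add: qnorm_def B)
      finally show ?thesis .
    qed
    then show "\<exists>N. \<forall>n\<ge>N. norm (A (x - y n)) \<le> sqrt (norm A) * sqrt (qform A (x - y n) + qform B (y n))"
      by blast
  qed
  \<comment> \<open>The competitor \<open>z = 0\<close> shows that the minimum is at most
    \<open>qform A x\<close>.\<close>
  also have "\<dots> \<le> sqrt (norm A) * qnorm A x"
    using y(3)[of 0] by (intro mult_left_mono) (simp_all add: qnorm_def)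
  also have "\<dots> \<le> norm x * norm A" by (rule sqrt_norm_qnorm_le)
  finally show ?thesis .
qed

lemma LIMSEQ_one_over_Suc: "(\<lambda>n. 1 / real (Suc n)) \<longlonglongrightarrow> 0"
  by (rule LIMSEQ_inverse_real_of_nat[unfolded inverse_eq_divide])

text \<open>The argument for nearest points in a closed convex set: the parallelogram identity makes
  near-minimisers Cauchy in the seminorm of \<open>A + B\<close>. Near-minimality also makes the
  gradient small, so both limits in \<open>par_rel\<close> coincide.\<close>

lemma par_rel_exists:
  assumes A: "positive_op A" and B: "positive_op B"
  shows "\<exists>w. par_rel A B x w"
proof -
  define D where "D = A + B"
  have D: "positive_op D" unfolding D_def by (intro positive_op_add A B)
  define F where "F y = qform A (x - y) + qform B y" for y
  define m where "m = (INF y. F y)"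
  have bdd: "bdd_below (range F)"
    by (intro bdd_belowI[of _ 0]) (auto simp: F_def A B)
  have m_le: "m \<le> F y" for y
    unfolding m_def by (rule cINF_lower[OF bdd]) simp
  have "\<exists>y. F y < m + 1 / real (Suc n)" for n
    using cINF_less_iff[of UNIV F "m + 1 / real (Suc n)"] bdd
    by (simp add: m_def[symmetric])
  then obtain y where y: "F (y n) < m + 1 / real (Suc n)" for n by metis
  have Cauchy: "qCauchy D y"
    unfolding qCauchy_def
  proof (intro allI impI)
    fix e :: real assume "0 < e"
    \<comment> \<open>Below, \<open>2 F (y i) + 2 F (y j) - 4 F u\<close> is less than four times
      the tolerance, as the multiples of the infimum \<open>m\<close> cancel.\<close>
    then have "0 < e\<^sup>2 / 4" by simp
    then obtain N where N: "1 / real (Suc n) < e\<^sup>2 / 4" if "n \<ge> N" for n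
      using order_tendstoD(2)[OF LIMSEQ_one_over_Suc] unfolding eventually_sequentially by metis
    have "qnorm D (y i - y j) < e" if "i \<ge> N" "j \<ge> N" for i j
    proof -
      define u where "u = (1/2) *\<^sub>R (y i + y j)"
      have 2: "2 *\<^sub>R u = y i + y j" by (simp add: u_def)
      have "(x - y i) + (x - y j) = 2 *\<^sub>R (x - u)"
        using 2 by (simp add: algebra_simps scaleR_2)
      then have 3: "qform A (2 *\<^sub>R (x - u)) + qform A (y i - y j)
          = 2 * qform A (x - y i) + 2 * qform A (x - y j)"
        using qform_parallelogram[of A "x - y i" "x - y j"]
        by (simp add: qform_minus_commute[of A "y i"])
      have 4: "qform B (2 *\<^sub>R u) + qform B (y i - y j) = 2 * qform B (y i) + 2 * qform B (y j)"
        using qform_parallelogram[of B "y i" "y j"] 2 by simp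
      have "qform D (y i - y j) = 2 * F (y i) + 2 * F (y j) - 4 * F u"
        using 3 4 by (simp add: D_def qform_add_op F_def qform_scaleR)
      also have "\<dots> < e\<^sup>2"
        using y[of i] y[of j] m_le[of u] N[OF that(1)] N[OF that(2)] by linarith
      finally show ?thesis using \<open>0 < e\<close> by (simp add: qnorm_def real_less_lsqrt)
    qed
    then show "\<exists>N. \<forall>m\<ge>N. \<forall>n\<ge>N. qnorm D (y m - y n) < e" by blast
  qed
  define E where "E n = A (x - y n) - B (y n)" for n
  have "(norm (E n))\<^sup>2 \<le> norm D * (1 / real (Suc n))" for n
  proof -
    have exp: "F (y n + h) = F (y n) - 2 * Re (cinner (E n) h) + qform D h" for h
      using qform_diff[OF A, of "x - y n" h]
      by (simp add: F_def qform_add[OF B] E_def cinner_simps D_def qform_add_op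
          diff_diff_eq)
    \<comment> \<open>Moving from \<open>y n\<close> by any real multiple of the residual gains less
      than the tolerance \<open>1 / (n + 1)\<close>; the discriminant turns this into a bound on the
      residual.\<close>
    have "0 \<le> 1 / real (Suc n) + 2 * t * (- Re (cinner (E n) (E n))) + t\<^sup>2 * qform D (E n)" for t
      using exp[of "t *\<^sub>R E n"] m_le[of "y n + t *\<^sub>R E n"] y[of n]
      by (simp add: qform_scaleR cinner_simps algebra_simps)
    then have "(- Re (cinner (E n) (E n)))\<^sup>2 \<le> 1 / real (Suc n) * qform D (E n)"
      by (rule quadratic_nonneg_imp_discriminant) (simp add: D)
    also have "\<dots> \<le> 1 / real (Suc n) * (norm D * (norm (E n))\<^sup>2)"
      by (intro mult_left_mono qform_le_norm) simp
    finally have *: "(norm (E n))\<^sup>2 * (norm (E n))\<^sup>2 \<le> (norm D * (1 / real (Suc n))) * (norm (E n))\<^sup>2"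
      by (simp add: inner_cinner[symmetric] power2_norm_eq_inner[symmetric] power2_eq_square mult_ac)
    show ?thesis
    proof (cases "E n = 0")
      case False
      then show ?thesis using mult_right_le_imp_le[OF *] by simp
    qed simp
  qed
  then have "(\<lambda>n. (norm (E n))\<^sup>2) \<longlonglongrightarrow> 0"
    using tendsto_mult_left[OF LIMSEQ_one_over_Suc, of "norm D"]
    by (intro tendsto_sandwich[of "\<lambda>_. 0" "\<lambda>n. (norm (E n))\<^sup>2"]) (simp_all add: always_eventually)
  then have "(\<lambda>n. norm (E n)) \<longlonglongrightarrow> 0"
    using tendsto_real_sqrt[of "\<lambda>n. (norm (E n))\<^sup>2" 0] by simp
  then have E0: "E \<longlonglongrightarrow> 0" by (rule tendsto_norm_zero_cancel)
  have "qCauchy B y"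
    unfolding qCauchy_def
  proof (intro allI impI)
    fix e :: real assume "0 < e"
    then obtain N where "\<forall>m\<ge>N. \<forall>n\<ge>N. qnorm D (y m - y n) < e"
      using Cauchy unfolding qCauchy_def by blast
    moreover have "qnorm B z \<le> qnorm D z" for z by (simp add: qnorm_def D_def qform_add_op A)
    ultimately show "\<exists>N. \<forall>m\<ge>N. \<forall>n\<ge>N. qnorm B (y m - y n) < e"
      by (meson le_less_trans)
  qed
  then obtain w where w: "(\<lambda>n. B (y n)) \<longlonglongrightarrow> w"
    using qCauchy_image_convergent[OF B] unfolding convergent_def by blast
  have "(\<lambda>n. A (x - y n)) \<longlonglongrightarrow> w"
    using tendsto_add[OF E0 w] by (simp add: E_def)
  then show ?thesis using Cauchy w unfolding par_rel_def D_def by blast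
qed

section \<open>The parallel sum as an operator\<close>

lemma complex_linear_blinfunI:
  fixes f :: "'a::complex_hilbert_space \<Rightarrow> 'a"
  assumes "\<And>x y. f (x + y) = f x + f y" "\<And>c x. f (c *\<^sub>C x) = c *\<^sub>C f x"
    and "\<And>x. norm (f x) \<le> norm x * K"
  obtains C where "blinfun_apply C = f" "complex_linear_op C"
proof -
  have "bounded_linear f"
    by (rule bounded_linear_intro[of f K]) (simp_all add: assms scaleR_scaleC)
  then have "blinfun_apply (Blinfun f) = f" by (rule bounded_linear_Blinfun_apply)
  then show thesis using that[of "Blinfun f"] assms(2) by (simp add: complex_linear_op_def)
qed

text \<open>Uniqueness makes \<open>par_rel\<close> the graph of a map, and turns its closure under
  sums and multiples into linearity of that map.\<close>

lemma parallel_sum_exists: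
  assumes A: "positive_op A" and B: "positive_op B"
  obtains C where "positive_op C" "\<And>x. qform C x = (INF y. qform A (x - y) + qform B y)"
proof -
  define f where "f x = (THE w. par_rel A B x w)" for x
  have f: "par_rel A B x (f x)" for x
    unfolding f_def using par_rel_exists[OF A B] par_rel_unique[OF A B] by (rule_tac theI') blast
  have f_eq: "f x = w" if "par_rel A B x w" for x w
    using par_rel_unique[OF A B f that] .
  obtain C where C: "blinfun_apply C = f" "complex_linear_op C"
  proof (rule complex_linear_blinfunI[of f "norm A"])
    show "f (x + y) = f x + f y" for x y by (intro f_eq par_rel_add A B f)
    show "f (c *\<^sub>C x) = c *\<^sub>C f x" for c x by (intro f_eq par_rel_scaleC A B f)
    show "norm (f x) \<le> norm x * norm A" for x by (intro par_rel_norm_le[OF A B] f)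
  qed
  show thesis
  proof (rule that[of C])
    show "positive_op C"
      using C par_rel_qform[OF A B f] unfolding positive_op_def by metis
    show "qform C x = (INF y. qform A (x - y) + qform B y)" for x
    proof -
      obtain y where y: "(\<lambda>n. qform A (x - y n) + qform B (y n)) \<longlonglongrightarrow> Re (cinner (f x) x)"
          "\<And>z. Re (cinner (f x) x) \<le> qform A (x - z) + qform B z"
        using par_rel_qform[OF A B f] by metis
      have "(INF y. qform A (x - y) + qform B y) = Re (cinner (f x) x)"
      proof (rule antisym)
        show "Re (cinner (f x) x) \<le> (INF y. qform A (x - y) + qform B y)"
          by (rule cINF_greatest) (simp_all add: y)
        have "bdd_below (range (\<lambda>y. qform A (x - y) + qform B y))"
          by (intro bdd_belowI[of _ 0]) (auto simp: A B)
        then show "(INF y. qform A (x - y) + qform B y) \<le> Re (cinner (f x) x)"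
          using y(1) by (intro LIMSEQ_le_const) (auto intro!: cINF_lower)
      qed
      then show ?thesis by (simp add: qform_def C)
    qed
  qed
qed

lemma
  assumes A: "positive_op A" and B: "positive_op B"
  shows positive_op_parallel_sum: "positive_op (parallel_sum A B)"
    and qform_parallel_sum: "qform (parallel_sum A B) x = (INF y. qform A (x - y) + qform B y)"
proof -
  let ?P = "\<lambda>C. positive_op C \<and> (\<forall>x. cinner (C x) x =
    complex_of_real (INF y. Re (cinner (A (x - y)) (x - y)) + Re (cinner (B y) y)))"
  obtain C where C: "positive_op C" "\<And>x. qform C x = (INF y. qform A (x - y) + qform B y)"
    using parallel_sum_exists[OF A B] by blast
  then have "?P C" by (simp add: cinner_positive_op qform_def[of A] qform_def[of B])
  moreover have "D = C" if "?P D" for D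
  proof (rule positive_op_eqI)
    show "qform D x = qform C x" for x
      using that unfolding C(2) by (simp add: qform_def)
  qed (use that C in simp_all)
  ultimately have "parallel_sum A B = C"
    unfolding parallel_sum_def by (rule the_equality)
  then show "positive_op (parallel_sum A B)"
    and "qform (parallel_sum A B) x = (INF y. qform A (x - y) + qform B y)"
    using C by simp_all
qed

lemma qform_parallel_sum_le:
  "positive_op A \<Longrightarrow> positive_op B \<Longrightarrow> qform (parallel_sum A B) x \<le> qform A (x - y) + qform B y"
  unfolding qform_parallel_sum
  by (rule cINF_lower) (auto intro!: bdd_belowI[of _ 0])

lemma le_qform_parallel_sum:
  "positive_op A \<Longrightarrow> positive_op B \<Longrightarrow> (\<And>y. r \<le> qform A (x - y) + qform B y) \<Longrightarrow>
    r \<le> qform (parallel_sum A B) x"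
  unfolding qform_parallel_sum by (rule cINF_greatest) simp_all

lemma parallel_sum_approx:
  assumes "positive_op A" "positive_op B" "0 < e"
  obtains y where "qform A (x - y) + qform B y < qform (parallel_sum A B) x + e"
proof -
  have "\<not> (\<forall>y. qform (parallel_sum A B) x + e \<le> qform A (x - y) + qform B y)"
    using le_qform_parallel_sum[OF assms(1,2), of "qform (parallel_sum A B) x + e" x] assms(3) by fastforce
  then show thesis using that by (auto simp: not_le)
qed

section \<open>Generalized short\<close>

text \<open>The forms converge as bounded monotone real sequences. Since \<open>T n - T m\<close> is
  positive and dominated by \<open>B\<close>, its value at \<open>x\<close> has norm at most
  \<open>sqrt (norm B)\<close> times the root of the increment of the forms, which makes the vectors
  Cauchy as well.\<close>

lemma increasing_positive_op_limit:
  fixes T :: "nat \<Rightarrow> 'a::complex_hilbert_space \<Rightarrow>\<^sub>L 'a"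
  assumes T: "\<And>n. positive_op (T n)" and B: "positive_op B"
    and mono: "\<And>m n x. m \<le> n \<Longrightarrow> qform (T m) x \<le> qform (T n) x"
    and le: "\<And>n x. qform (T n) x \<le> qform B x"
  obtains C where "positive_op C" "\<And>x. (\<lambda>n. T n x) \<longlonglongrightarrow> C x"
proof -
  have conv: "convergent (\<lambda>n. T n x)" for x
  proof (rule Cauchy_convergent, rule CauchyI)
    fix e :: real assume "0 < e"
    define K where "K = norm B + 1"
    have K: "0 < K" by (simp add: K_def add_nonneg_pos)
    have "convergent (\<lambda>n. qform (T n) x)"
      by (rule Bseq_mono_convergent)
        (use T le[of _ x] mono in \<open>auto simp: Bseq_def intro!: exI[of _ "qform B x + 1"] add_nonneg_pos
          qform_nonneg[OF B] order_trans[OF le]\<close>)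
    then have "Cauchy (\<lambda>n. qform (T n) x)" by (simp add: Cauchy_convergent_iff)
    moreover have "0 < e\<^sup>2 / K" using K \<open>0 < e\<close> by simp
    ultimately obtain N where N: "\<forall>m\<ge>N. \<forall>n\<ge>N. norm (qform (T m) x - qform (T n) x) < e\<^sup>2 / K"
      using CauchyD by blast
    have *: "norm (T n x - T m x) < e" if "m \<ge> N" "m \<le> n" for m n
    proof -
      have pos: "positive_op (T n - T m)"
        using op_le_iff_qform[OF T T] mono[OF that(2)] by (simp add: op_le_def)
      have "norm ((T n - T m) x) \<le> sqrt (norm B) * qnorm (T n - T m) x"
      proof (rule norm_positive_op_le[OF pos])
        show "qform (T n - T m) z \<le> qform B z" for z
          using le[of n z] qform_nonneg[OF T[of m], of z] by (simp add: qform_diff_op)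
      qed
      also have "\<dots> = sqrt (norm B * qform (T n - T m) x)"
        by (simp add: qnorm_def real_sqrt_mult)
      also have "\<dots> < e"
      proof (rule real_less_lsqrt)
        have "qform (T n - T m) x < e\<^sup>2 / K"
          using N[rule_format, of n m] that by (simp add: qform_diff_op)
        then have "K * qform (T n - T m) x < e\<^sup>2" using K by (simp add: field_simps)
        then show "norm B * qform (T n - T m) x < e\<^sup>2"
          using qform_nonneg[OF pos, of x] by (simp add: K_def algebra_simps)
      qed (use pos \<open>0 < e\<close> in simp_all)
      finally show ?thesis by (simp add: blinfun.diff_left)
    qed
    have "norm (T m x - T n x) < e" if "m \<ge> N" "n \<ge> N" for m n
      using *[of m n] *[of n m] that by (cases "m \<le> n") (auto simp: norm_minus_commute)
    then show "\<exists>N. \<forall>m\<ge>N. \<forall>n\<ge>N. norm (T m x - T n x) < e" by blast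
  qed
  define f where "f x = lim (\<lambda>n. T n x)" for x
  have f: "(\<lambda>n. T n x) \<longlonglongrightarrow> f x" for x
    using conv unfolding f_def by (simp add: convergent_LIMSEQ_iff)
  obtain C where C: "blinfun_apply C = f" "complex_linear_op C"
  proof (rule complex_linear_blinfunI[of f "norm B"])
    show "f (x + y) = f x + f y" for x y
      using tendsto_add[OF f[of x] f[of y]] by (intro LIMSEQ_unique[OF f]) (simp add: blinfun.add_right)
    show "f (c *\<^sub>C x) = c *\<^sub>C f x" for c x
      using tendsto_scaleC[OF f[of x], of c]
      by (intro LIMSEQ_unique[OF f]) (simp add: positive_op_scaleC[OF T])
    show "norm (f x) \<le> norm x * norm B" for x
    proof (rule LIMSEQ_le_const2[OF tendsto_norm[OF f]])
      have "norm (T n x) \<le> norm x * norm B" for n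
      proof -
        have "norm (T n x) \<le> sqrt (norm B) * qnorm (T n) x" by (rule norm_positive_op_le[OF T le])
        also have "\<dots> \<le> sqrt (norm B) * qnorm B x"
          by (intro mult_left_mono) (simp_all add: qnorm_def le)
        also have "\<dots> \<le> norm x * norm B" by (rule sqrt_norm_qnorm_le)
        finally show ?thesis .
      qed
      then show "\<exists>N. \<forall>n\<ge>N. norm (T n x) \<le> norm x * norm B" by blast
    qed
  qed
  show thesis
  proof (rule that[of C])
    have "cinner (C x) x \<in> \<real>\<^sub>\<ge>\<^sub>0" for x
    proof (rule closed_sequentially[OF closed_nonneg_Reals_complex])
      show "(\<lambda>n. cinner (T n x) x) \<longlonglongrightarrow> cinner (C x) x"
        unfolding C by (intro tendsto_intros f)
      show "cinner (T n x) x \<in> \<real>\<^sub>\<ge>\<^sub>0" for n using T by (simp add: positive_op_def)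
    qed
    then show "positive_op C" using C by (simp add: positive_op_def)
  qed (simp add: C f)
qed

text \<open>Enlarging \<open>n\<close> raises the functional at every competitor, hence its infimum,
  and the competitor \<open>y = 0\<close> keeps the infimum below the form of \<open>B\<close>. The
  monotone limit is then the operator described by the definition.\<close>

lemma
  assumes A: "positive_op A" and B: "positive_op B"
  shows positive_op_generalized_short: "positive_op (generalized_short A B)"
    and qform_generalized_short:
      "(\<lambda>n. qform (parallel_sum B (real n *\<^sub>R A)) x) \<longlonglongrightarrow> qform (generalized_short A B) x"
    and incseq_qform_parallel_sum: "incseq (\<lambda>n. qform (parallel_sum B (real n *\<^sub>R A)) x)"
proof -
  have nA: "positive_op (real n *\<^sub>R A)" for n by (simp add: positive_op_scaleR A)
  let ?T = "\<lambda>n. parallel_sum B (real n *\<^sub>R A)"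
  have T: "positive_op (?T n)" for n by (intro positive_op_parallel_sum B nA)
  have mono: "qform (?T m) x \<le> qform (?T n) x" if "m \<le> n" for m n x
  proof (rule le_qform_parallel_sum[OF B nA])
    fix y
    have "qform (?T m) x \<le> qform B (x - y) + qform (real m *\<^sub>R A) y"
      by (rule qform_parallel_sum_le[OF B nA])
    also have "\<dots> \<le> qform B (x - y) + qform (real n *\<^sub>R A) y"
      using that A by (simp add: qform_scaleR_op mult_right_mono)
    finally show "qform (?T m) x \<le> qform B (x - y) + qform (real n *\<^sub>R A) y" .
  qed
  then show "incseq (\<lambda>n. qform (?T n) x)" by (simp add: incseq_def)
  have le: "qform (?T n) x \<le> qform B x" for n x
    using qform_parallel_sum_le[OF B nA, of n x 0] by simp
  obtain C where C: "positive_op C" "\<And>x. (\<lambda>n. ?T n x) \<longlonglongrightarrow> C x"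
    using increasing_positive_op_limit[of ?T, OF T B mono le] by blast
  then have "generalized_short A B = C"
    unfolding generalized_short_def by (intro the_equality blinfun_eqI) (blast intro: LIMSEQ_unique)+
  then show "positive_op (generalized_short A B)"
    and "(\<lambda>n. qform (?T n) x) \<longlonglongrightarrow> qform (generalized_short A B) x"
    using C(1) tendsto_Re[OF tendsto_cinner[OF C(2)[of x] tendsto_const[of x]]]
    by (simp_all add: qform_def)
qed

section \<open>The projection relation\<close>

text \<open>With \<open>B = A + C\<close> and \<open>A = J\<^sub>B T J\<^sub>B\<^sup>*\<close> in the auxiliary space of \<open>B\<close>, the
  condition says that \<open>y\<close> approximates \<open>T x\<close> and that \<open>T\<close> acts like a projection at \<open>x\<close>.\<close>

definition proj_rel ::
    "('a::complex_hilbert_space \<Rightarrow>\<^sub>L 'a) \<Rightarrow> ('a \<Rightarrow>\<^sub>L 'a) \<Rightarrow> (nat \<Rightarrow> 'a) \<Rightarrow> (nat \<Rightarrow> 'a) \<Rightarrow> bool" where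
  "proj_rel A C x y \<longleftrightarrow>
     (\<lambda>n. qnorm A (x n - y n)) \<longlonglongrightarrow> 0 \<and> (\<lambda>n. qnorm C (y n)) \<longlonglongrightarrow> 0"

text \<open>Only constant sequences are asked for, which stand for the vectors of the dense range;
  \<open>proj_rel_exists\<close> extends the condition to arbitrary sequences.\<close>

definition splitting :: "('a::complex_hilbert_space \<Rightarrow>\<^sub>L 'a) \<Rightarrow> ('a \<Rightarrow>\<^sub>L 'a) \<Rightarrow> bool" where
  "splitting A C \<longleftrightarrow> (\<forall>x. \<exists>y. proj_rel A C (\<lambda>n. x) y)"

lemma qnorm_null_le:
  assumes "positive_op A" "\<And>n. qnorm A (x n) \<le> b n" "b \<longlonglongrightarrow> 0"
  shows "(\<lambda>n. qnorm A (x n)) \<longlonglongrightarrow> 0"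
  by (rule tendsto_sandwich[of "\<lambda>_. 0" _ _ b]) (simp_all add: assms)

lemma qnorm_diff_tendsto:
  assumes A: "positive_op A" and xy: "(\<lambda>n. qnorm A (x n - y n)) \<longlonglongrightarrow> 0"
  shows "(\<lambda>n. qnorm A (x n) - qnorm A (y n)) \<longlonglongrightarrow> 0"
proof (rule tendsto_rabs_zero_cancel, rule tendsto_sandwich[of "\<lambda>_. 0" _ _ "\<lambda>n. qnorm A (x n - y n)"])
  show "\<forall>\<^sub>F n in sequentially. \<bar>qnorm A (x n) - qnorm A (y n)\<bar> \<le> qnorm A (x n - y n)"
    using qnorm_reverse_triangle[OF A] by simp
qed (simp_all add: xy)

lemma qform_tendsto:
  assumes A: "positive_op A" and y: "(\<lambda>n. qnorm A (x - y n)) \<longlonglongrightarrow> 0"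
  shows "(\<lambda>n. qform A (y n)) \<longlonglongrightarrow> qform A x"
proof -
  have "(\<lambda>n. qnorm A x - (qnorm A x - qnorm A (y n))) \<longlonglongrightarrow> qnorm A x - 0"
    by (intro tendsto_intros qnorm_diff_tendsto[OF A y])
  then have "(\<lambda>n. (qnorm A (y n))\<^sup>2) \<longlonglongrightarrow> (qnorm A x)\<^sup>2"
    by (intro tendsto_power) simp
  then show ?thesis by (simp add: qnorm_power2[OF A])
qed

text \<open>In the auxiliary space this is \<open>||Tx||^2 = (Tx|x)\<close>. The sequence on the
  left depends on \<open>A\<close> and \<open>C\<close> only through their sum, so two
  decompositions of one operator that share \<open>y\<close> have the same forms.\<close>

lemma proj_rel_qform_tendsto:
  assumes A: "positive_op A" and C: "positive_op C" and xy: "proj_rel A C (\<lambda>n. x) y"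
  shows "(\<lambda>n. qform (A + C) (y n)) \<longlonglongrightarrow> qform A x"
  using tendsto_add[OF qform_tendsto[OF A, of x y], of "\<lambda>n. qform C (y n)" 0] xy
  by (simp add: proj_rel_def tendsto_qform_zero_iff[OF C] qform_add_op)

lemma proj_relI:
  assumes A: "positive_op A" and C: "positive_op C"
    and le: "\<And>n. qform A (x n - y n) + qform C (y n) \<le> b n" and b: "b \<longlonglongrightarrow> 0"
  shows "proj_rel A C x y"
proof -
  have "(\<lambda>n. qform A (x n - y n)) \<longlonglongrightarrow> 0"
  proof (rule tendsto_sandwich[of "\<lambda>_. 0" _ _ b])
    show "\<forall>\<^sub>F n in sequentially. qform A (x n - y n) \<le> b n"
      using order_trans[OF _ le] C by simp
  qed (simp_all add: A b)
  moreover have "(\<lambda>n. qform C (y n)) \<longlonglongrightarrow> 0"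
  proof (rule tendsto_sandwich[of "\<lambda>_. 0" _ _ b])
    show "\<forall>\<^sub>F n in sequentially. qform C (y n) \<le> b n"
      using order_trans[OF _ le] A by simp
  qed (simp_all add: C b)
  ultimately show ?thesis
    by (simp add: proj_rel_def tendsto_qform_zero_iff[OF A] tendsto_qform_zero_iff[OF C])
qed

lemma proj_relD:
  assumes A: "positive_op A" and C: "positive_op C" and xy: "proj_rel A C x y"
  shows "(\<lambda>n. qform A (x n - y n) + qform C (y n)) \<longlonglongrightarrow> 0"
  using tendsto_add[of "\<lambda>n. qform A (x n - y n)" 0 _ "\<lambda>n. qform C (y n)" 0] xy
  by (simp add: proj_rel_def tendsto_qform_zero_iff A C)

section \<open>Parallel sum, singularity, extreme points and generalized short in terms of
  splittings\<close>

lemma splitting_iff_parallel_sum: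
  assumes A: "positive_op A" and C: "positive_op C"
  shows "splitting A C \<longleftrightarrow> parallel_sum A C = 0"
proof
  assume split: "splitting A C"
  show "parallel_sum A C = 0"
  proof (rule positive_op_eqI)
    fix x
    obtain y where "proj_rel A C (\<lambda>n. x) y" using split by (auto simp: splitting_def)
    then have "(\<lambda>n. qform A (x - y n) + qform C (y n)) \<longlonglongrightarrow> 0"
      by (rule proj_relD[OF A C])
    then have "qform (parallel_sum A C) x \<le> 0"
      using qform_parallel_sum_le[OF A C] by (intro LIMSEQ_le_const) auto
    then show "qform (parallel_sum A C) x = qform 0 x"
      using qform_nonneg[OF positive_op_parallel_sum[OF A C], of x] by (simp add: qform_def[of 0])
  qed (simp_all add: positive_op_parallel_sum A C positive_op_zero)
next
  assume 0: "parallel_sum A C = 0"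
  show "splitting A C"
    unfolding splitting_def
  proof
    fix x
    have "\<exists>y. qform A (x - y) + qform C y < 1 / real (Suc n)" for n
      using parallel_sum_approx[OF A C, of "1 / real (Suc n)" x] by (auto simp: 0 qform_def[of 0])
    then obtain y where "qform A (x - y n) + qform C (y n) < 1 / real (Suc n)" for n by metis
    then show "\<exists>y. proj_rel A C (\<lambda>n. x) y"
      by (intro exI[of _ y] proj_relI[OF A C _ LIMSEQ_one_over_Suc] less_imp_le)
  qed
qed

text \<open>The competitor \<open>y = 0\<close> gives the bound by \<open>A\<close>, and
  \<open>y = x\<close> the bound by \<open>C\<close>.\<close>

lemma parallel_sum_op_le:
  assumes "positive_op A" "positive_op C"
  shows "parallel_sum A C \<preceq> A" "parallel_sum A C \<preceq> C"
  using assms qform_parallel_sum_le[OF assms, of _ 0] qform_parallel_sum_le[OF assms, of x x for x]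
  by (simp_all add: op_le_iff_qform positive_op_parallel_sum)

text \<open>\<open>A : C\<close> lies below both operators, so singularity annihilates it.
  Conversely, an operator \<open>D\<close> below both is tested on
  \<open>x = (x - y n) + y n\<close>: the first summand is small for \<open>A\<close>, the second
  for \<open>C\<close>, hence both for \<open>D\<close>.\<close>

lemma singular_ops_iff_splitting:
  assumes A: "positive_op A" and C: "positive_op C"
  shows "singular_ops A C \<longleftrightarrow> splitting A C"
proof
  assume "singular_ops A C"
  then show "splitting A C"
    using positive_op_parallel_sum[OF A C] parallel_sum_op_le[OF A C]
    by (simp add: splitting_iff_parallel_sum[OF A C] singular_ops_def)
next
  assume split: "splitting A C"
  show "singular_ops A C"
    unfolding singular_ops_def
  proof (intro allI impI)
    fix D assume D: "positive_op D" and "D \<preceq> A" "D \<preceq> C"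
    then have le: "qnorm D z \<le> qnorm A z" "qnorm D z \<le> qnorm C z" for z
      by (simp_all add: op_le_iff_qform A C qnorm_def)
    show "D = 0"
    proof (rule positive_op_eqI)
      fix x
      obtain y where y: "proj_rel A C (\<lambda>n. x) y" using split by (auto simp: splitting_def)
      have "qnorm D x \<le> 0"
      proof (rule LIMSEQ_le_const)
        show "(\<lambda>n. qnorm A (x - y n) + qnorm C (y n)) \<longlonglongrightarrow> 0"
          using y tendsto_add[of _ 0 _ _ 0] by (fastforce simp: proj_rel_def)
        have "qnorm D x \<le> qnorm A (x - y n) + qnorm C (y n)" for n
          using qnorm_triangle[OF D, of "x - y n" "y n"] le[of "x - y n"] le[of "y n"] by simp
        then show "\<exists>N. \<forall>n\<ge>N. qnorm D x \<le> qnorm A (x - y n) + qnorm C (y n)" by blast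
      qed
      then show "qform D x = qform 0 x"
        using qform_nonneg[OF D, of x] by (simp add: qnorm_def qform_def[of 0])
    qed (simp_all add: D positive_op_zero)
  qed
qed

text \<open>\<open>A\<close> is the midpoint of \<open>A - D\<close> and \<open>A + D\<close> for
  \<open>D = A : C\<close>, and both lie in the interval because \<open>D\<close> is below
  \<open>A\<close> and below \<open>C\<close>; extremality thus forces \<open>D = 0\<close>. The
  converse shows that both end points of a segment through \<open>A\<close> coincide with
  \<open>A\<close>.\<close>

lemma extreme_point_iff_splitting:
  assumes A: "positive_op A" and C: "positive_op C"
  shows "A extreme_point_of (op_interval 0 (A + C)) \<longleftrightarrow> splitting A C"
proof
  assume ext: "A extreme_point_of (op_interval 0 (A + C))"
  define D where "D = parallel_sum A C"
  have D: "positive_op D" and DA: "positive_op (A - D)" and DC: "positive_op (C - D)"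
    using positive_op_parallel_sum[OF A C] parallel_sum_op_le[OF A C] by (simp_all add: D_def op_le_def)
  have "A - D \<in> op_interval 0 (A + C)" "A + D \<in> op_interval 0 (A + C)"
    using positive_op_add[OF C D] positive_op_add[OF A D] DA DC
    by (simp_all add: op_interval_def op_le_def algebra_simps)
  then have "A \<notin> open_segment (A - D) (A + D)"
    using ext by (simp add: extreme_point_of_def)
  moreover have "A = (1 - 1/2) *\<^sub>R (A - D) + (1/2) *\<^sub>R (A + D)"
    by (simp add: scaleR_diff_right scaleR_add_right scaleR_left.add[symmetric])
  ultimately have "A - D = A + D"
    unfolding in_segment(2) by (auto dest!: spec[of _ "1/2"])
  then have "2 *\<^sub>R D = 0" by (simp add: scaleR_2 eq_neg_iff_add_eq_0 neg_eq_iff_add_eq_0)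
  then show "splitting A C"
    by (simp add: splitting_iff_parallel_sum[OF A C] D_def)
next
  assume split: "splitting A C"
  \<comment> \<open>\<open>u X\<close> below \<open>A\<close> and \<open>u (A + C - X)\<close> below
    \<open>C\<close> make the sequence that splits \<open>A\<close> and \<open>C\<close> also split
    \<open>X\<close> and \<open>A + C - X\<close>. Both pairs have the sum \<open>A + C\<close>, so
    both forms are the limit of the same sequence. The end points of a segment satisfy this with
    their own weights as \<open>u\<close>.\<close>
  have eq: "X = A"
    if X: "X \<in> op_interval 0 (A + C)" and u: "0 < u"
      and leA: "\<And>z. u * qform X z \<le> qform A z" and leC: "\<And>z. u * qform (A + C - X) z \<le> qform C z"
    for X u
  proof (rule positive_op_eqI)
    show Xpos: "positive_op X" using X by (simp add: op_interval_def)
    have Ypos: "positive_op (A + C - X)" using X by (simp add: op_interval_def op_le_def)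
    fix x
    obtain y where y: "proj_rel A C (\<lambda>n. x) y" using split by (auto simp: splitting_def)
    have "proj_rel X (A + C - X) (\<lambda>n. x) y"
    proof (rule proj_relI[OF Xpos Ypos])
      show "(\<lambda>n. (qform A (x - y n) + qform C (y n)) / u) \<longlonglongrightarrow> 0"
        using tendsto_divide[OF proj_relD[OF A C y] tendsto_const, of u] u by simp
      show "qform X (x - y n) + qform (A + C - X) (y n) \<le> (qform A (x - y n) + qform C (y n)) / u" for n
        using leA[of "x - y n"] leC[of "y n"] u by (simp add: pos_le_divide_eq algebra_simps)
    qed
    from proj_rel_qform_tendsto[OF Xpos Ypos this]
    have "(\<lambda>n. qform (A + C) (y n)) \<longlonglongrightarrow> qform X x" by simp
    then show "qform X x = qform A x"
      using proj_rel_qform_tendsto[OF A C y] LIMSEQ_unique by blast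
  qed (rule A)
  show "A extreme_point_of (op_interval 0 (A + C))"
    unfolding extreme_point_of_def
  proof (intro conjI ballI notI)
    show "A \<in> op_interval 0 (A + C)" using A C by (simp add: op_interval_def op_le_def)
    fix X Y assume X: "X \<in> op_interval 0 (A + C)" and Y: "Y \<in> op_interval 0 (A + C)"
      and "A \<in> open_segment X Y"
    then obtain u where "X \<noteq> Y" and u: "0 < u" "u < 1" and Aeq: "A = (1 - u) *\<^sub>R X + u *\<^sub>R Y"
      unfolding in_segment(2) by blast
    have pos: "positive_op X" "positive_op Y" "positive_op (A + C - X)" "positive_op (A + C - Y)"
      using X Y by (simp_all add: op_interval_def op_le_def)
    have qA: "qform A z = (1 - u) * qform X z + u * qform Y z" for z
      by (subst Aeq) (simp add: qform_add_op qform_scaleR_op)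
    have qC: "qform C z = (1 - u) * qform (A + C - X) z + u * qform (A + C - Y) z" for z
      by (simp add: qform_add_op qform_diff_op qA algebra_simps)
    have "X = A"
      by (rule eq[OF X, of "1 - u"]) (use u pos in \<open>simp_all add: qA qC\<close>)
    moreover have "Y = A"
      by (rule eq[OF Y, of u]) (use u pos in \<open>simp_all add: qA qC\<close>)
    ultimately show False using \<open>X \<noteq> Y\<close> by simp
  qed
qed

text \<open>The lower bound comes from \<open>B : (nA)\<close> being at least
  \<open>A : (nA)\<close>, which is \<open>n / (n + 1)\<close> times \<open>A\<close>. A splitting
  supplies competitors for the upper bound; conversely, near-minimisers for growing weights on
  \<open>A\<close> supply a splitting.\<close>

lemma generalized_short_iff_splitting:
  assumes A: "positive_op A" and C: "positive_op C"
  shows "A = generalized_short A (A + C) \<longleftrightarrow> splitting A C"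
proof -
  define B where "B = A + C"
  have B: "positive_op B" unfolding B_def by (intro positive_op_add A C)
  have nA: "positive_op (real n *\<^sub>R A)" for n by (simp add: positive_op_scaleR A)
  define T where "T n = parallel_sum B (real n *\<^sub>R A)" for n
  have T_lim: "(\<lambda>n. qform (T n) x) \<longlonglongrightarrow> qform (generalized_short A B) x" for x
    unfolding T_def by (rule qform_generalized_short[OF A B])
  have "A = generalized_short A B" if split: "splitting A C"
  proof (rule positive_op_eqI)
    fix x
    obtain y where y: "proj_rel A C (\<lambda>n. x) y" using split by (auto simp: splitting_def)
    have "qform (generalized_short A B) x \<le> qform A x"
    proof (rule LIMSEQ_le_const2[OF T_lim])
      have "qform (T n) x \<le> qform A x" for n
      proof (rule LIMSEQ_le_const)
        \<comment> \<open>These are the values at the competitor \<open>x - y k\<close>; with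
          \<open>n\<close> fixed, the weighted term dies out as \<open>k\<close> grows.\<close>
        have "(\<lambda>k. qform B (y k) + real n * qform A (x - y k)) \<longlonglongrightarrow> qform A x + real n * 0"
          using y proj_rel_qform_tendsto[OF A C y] unfolding B_def
          by (intro tendsto_intros) (simp_all add: proj_rel_def tendsto_qform_zero_iff A)
        then show "(\<lambda>k. qform B (y k) + real n * qform A (x - y k)) \<longlonglongrightarrow> qform A x" by simp
        have "qform (T n) x \<le> qform B (y k) + real n * qform A (x - y k)" for k
          using qform_parallel_sum_le[OF B nA, of n x "x - y k"] by (simp add: T_def qform_scaleR_op)
        then show "\<exists>N. \<forall>k\<ge>N. qform (T n) x \<le> qform B (y k) + real n * qform A (x - y k)" by blast
      qed
      then show "\<exists>N. \<forall>n\<ge>N. qform (T n) x \<le> qform A x" by blast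
    qed
    moreover have "qform A x \<le> qform (generalized_short A B) x"
    proof (rule LIMSEQ_le[OF _ T_lim])
      have "(\<lambda>n. real n / real (Suc n) * qform A x) \<longlonglongrightarrow> 1 * qform A x"
        by (intro tendsto_intros LIMSEQ_n_over_Suc_n)
      then show "(\<lambda>n. real n / real (Suc n) * qform A x) \<longlonglongrightarrow> qform A x" by simp
      have "real n / real (Suc n) * qform A x \<le> qform (T n) x" for n
        unfolding T_def
      proof (rule le_qform_parallel_sum[OF B nA])
        fix y
        \<comment> \<open>The minimum of \<open>(A(x - y)|x - y) + n(Ay|y)\<close> is attained at \<open>y = x / (n + 1)\<close>.\<close>
        have "0 \<le> qform A (x - real (Suc n) *\<^sub>R y)" by (simp add: A)
        then have "0 \<le> qform A x - 2 * (real (Suc n) * Re (cinner (A x) y)) + (real (Suc n))\<^sup>2 * qform A y"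
          by (simp add: qform_diff[OF A] qform_scaleR cinner_simps del: of_nat_Suc)
        then have "real n * qform A x \<le> real (Suc n) * (qform A (x - y) + real n * qform A y)"
          by (simp add: qform_diff[OF A] algebra_simps power2_eq_square)
        then have "real n / real (Suc n) * qform A x \<le> qform A (x - y) + real n * qform A y"
          by (simp add: pos_divide_le_eq mult.commute del: of_nat_Suc)
        also have "\<dots> \<le> qform B (x - y) + qform (real n *\<^sub>R A) y"
          by (simp add: B_def qform_add_op qform_scaleR_op C)
        finally show "real n / real (Suc n) * qform A x \<le> qform B (x - y) + qform (real n *\<^sub>R A) y" .
      qed
      then show "\<exists>N. \<forall>n\<ge>N. real n / real (Suc n) * qform A x \<le> qform (T n) x" by blast
    qed
    ultimately show "qform A x = qform (generalized_short A B) x" by simp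
  qed (intro A positive_op_generalized_short B)+
  moreover have "splitting A C" if eq: "A = generalized_short A B"
    unfolding splitting_def
  proof
    fix x
    have T_le: "qform (T n) x \<le> qform A x" for n
      using incseq_le[OF _ T_lim] incseq_qform_parallel_sum[OF A B] eq by (simp add: T_def)
    \<comment> \<open>The weight is \<open>Suc n\<close> because it has to be nonzero to control
      \<open>qform A y\<close>.\<close>
    have "\<exists>y. qform B (x - y) + real (Suc n) * qform A y < qform A x + 1 / real (Suc n)" for n
    proof -
      obtain y where "qform B (x - y) + qform (real (Suc n) *\<^sub>R A) y < qform (T (Suc n)) x + 1 / real (Suc n)"
        using parallel_sum_approx[OF B nA, of "1 / real (Suc n)" x "Suc n"] unfolding T_def by auto
      also have "\<dots> \<le> qform A x + 1 / real (Suc n)" using T_le by simp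
      finally show ?thesis unfolding qform_scaleR_op by blast
    qed
    then obtain y where y: "qform B (x - y n) + real (Suc n) * qform A (y n) < qform A x + 1 / real (Suc n)"
      for n by metis
    have one_over_le: "1 / real (Suc n) \<le> 1" for n by simp
    \<comment> \<open>The form multiplied by the weight \<open>n + 1\<close> stays bounded, so the
      form itself tends to 0.\<close>
    have y1: "qform A (y n) \<le> (qform A x + 1) * (1 / real (Suc n))" for n
    proof -
      have "real (Suc n) * qform A (y n) \<le> qform A x + 1"
        using y[of n] qform_nonneg[OF B, of "x - y n"] one_over_le[of n] by linarith
      then show ?thesis by (simp add: pos_le_divide_eq mult.commute del: of_nat_Suc)
    qed
    have yA: "(\<lambda>n. qform A (y n)) \<longlonglongrightarrow> 0"
    proof (rule tendsto_sandwich[of "\<lambda>_. 0"])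
      show "(\<lambda>n. (qform A x + 1) * (1 / real (Suc n))) \<longlonglongrightarrow> 0"
        using tendsto_mult_left[OF LIMSEQ_one_over_Suc, of "qform A x + 1"] by simp
    qed (use y1 A in simp_all)
    have "(\<lambda>n. qform A (x - y n)) \<longlonglongrightarrow> qform A x"
      using yA by (intro qform_tendsto[OF A]) (simp add: tendsto_qform_zero_iff[OF A])
    then have "(\<lambda>n. qform A (y n) + (qform A x + 1 / real (Suc n) - qform A (x - y n)))
        \<longlonglongrightarrow> 0 + (qform A x + 0 - qform A x)"
      by (intro tendsto_add tendsto_diff tendsto_const LIMSEQ_one_over_Suc yA)
    then have "proj_rel A C (\<lambda>n. x) (\<lambda>n. x - y n)"
    proof (intro proj_relI[OF A C])
      fix n
      \<comment> \<open>The form of \<open>B\<close> at \<open>x - y n\<close> is the sum of those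
        of \<open>A\<close> and \<open>C\<close>. The \<open>A\<close> part already tends to
        \<open>qform A x\<close>, which leaves nothing for \<open>C\<close> in the limit.\<close>
      have "qform C (x - y n) \<le> qform A x + 1 / real (Suc n) - qform A (x - y n)"
        using y[of n] mult_nonneg_nonneg[OF of_nat_0_le_iff qform_nonneg[OF A, of "y n"], of "Suc n"]
        unfolding B_def qform_add_op by linarith
      then show "qform A (x - (x - y n)) + qform C (x - y n)
          \<le> qform A (y n) + (qform A x + 1 / real (Suc n) - qform A (x - y n))" by simp
    qed simp
    then show "\<exists>y. proj_rel A C (\<lambda>n. x) y" by blast
  qed
  ultimately show ?thesis unfolding B_def by blast
qed

section \<open>The projection relation on Cauchy sequences\<close>

lemma qnorm_add_op_le:
  "positive_op A \<Longrightarrow> positive_op C \<Longrightarrow> qnorm (A + C) x \<le> qnorm A x + qnorm C x"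
  by (simp add: qnorm_def qform_add_op sqrt_add_le_add_sqrt)

lemma qnorm_le_qnorm_add_op:
  "positive_op A \<Longrightarrow> positive_op C \<Longrightarrow> qnorm A x \<le> qnorm (A + C) x"
  "positive_op A \<Longrightarrow> positive_op C \<Longrightarrow> qnorm C x \<le> qnorm (A + C) x"
  by (simp_all add: qnorm_def qform_add_op)

text \<open>\<open>T\<close> is a contraction, up to the two bracketed errors, which vanish along
  \<open>proj_rel\<close>. In the seminorm of \<open>A\<close> the points \<open>y\<close> and
  \<open>y'\<close> are close to \<open>x\<close> and \<open>x'\<close>; in that of \<open>C\<close>
  they are small. The estimate yields the Cauchy property, the independence of representatives and
  the norm bound of the projection.\<close>

lemma proj_rel_contraction:
  assumes A: "positive_op A" and C: "positive_op C"
  shows "qnorm (A + C) (y - y') \<le>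
    qnorm (A + C) (x - x') + (qnorm A (x - y) + qnorm C y) + (qnorm A (x' - y') + qnorm C y')"
proof -
  have "qnorm A (y - y') \<le> qnorm A (x - y) + (qnorm A (x - x') + qnorm A (x' - y'))"
    using qnorm_triangle_diff[OF A, of y y' x] qnorm_triangle_diff[OF A, of x y' x']
    by (simp add: qnorm_minus_commute[of A y x])
  moreover have "qnorm C (y - y') \<le> qnorm C y + qnorm C y'" by (rule qnorm_diff_le[OF C])
  ultimately show ?thesis
    using qnorm_add_op_le[OF A C, of "y - y'"] qnorm_le_qnorm_add_op(1)[OF A C, of "x - x'"] by linarith
qed

lemma proj_rel_error_tendsto:
  "proj_rel A C x y \<Longrightarrow> (\<lambda>n. qnorm A (x n - y n) + qnorm C (y n)) \<longlonglongrightarrow> 0"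
  unfolding proj_rel_def by (auto intro: tendsto_add_zero)

lemma proj_rel_qCauchy:
  assumes A: "positive_op A" and C: "positive_op C"
    and x: "qCauchy (A + C) x" and xy: "proj_rel A C x y"
  shows "qCauchy (A + C) y"
  unfolding qCauchy_def
proof (intro allI impI)
  fix e :: real assume "0 < e"
  define d where "d n = qnorm A (x n - y n) + qnorm C (y n)" for n
  have "d \<longlonglongrightarrow> 0" unfolding d_def by (rule proj_rel_error_tendsto[OF xy])
  then obtain M where M: "\<And>n. n \<ge> M \<Longrightarrow> d n < e / 3"
    using order_tendstoD(2)[of d 0 sequentially "e / 3"] \<open>0 < e\<close> by (auto simp: eventually_sequentially)
  have "0 < e / 3" using \<open>0 < e\<close> by simp
  then obtain N where N: "\<forall>m\<ge>N. \<forall>n\<ge>N. qnorm (A + C) (x m - x n) < e / 3"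
    using x unfolding qCauchy_def by blast
  have "qnorm (A + C) (y m - y n) < e" if "m \<ge> max M N" "n \<ge> max M N" for m n
    using proj_rel_contraction[OF A C, of "y m" "y n" "x m" "x n"] M[of m] M[of n] N[rule_format, of m n] that
    unfolding d_def max.bounded_iff by linarith
  then show "\<exists>N. \<forall>m\<ge>N. \<forall>n\<ge>N. qnorm (A + C) (y m - y n) < e" by blast
qed

lemma proj_rel_cong:
  assumes A: "positive_op A" and C: "positive_op C"
    and "proj_rel A C x y" "proj_rel A C x' y'" "(\<lambda>n. qnorm (A + C) (x n - x' n)) \<longlonglongrightarrow> 0"
  shows "(\<lambda>n. qnorm (A + C) (y n - y' n)) \<longlonglongrightarrow> 0"
proof (rule qnorm_null_le[OF positive_op_add[OF A C]])
  show "qnorm (A + C) (y n - y' n) \<le> qnorm (A + C) (x n - x' n)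
      + (qnorm A (x n - y n) + qnorm C (y n)) + (qnorm A (x' n - y' n) + qnorm C (y' n))" for n
    by (rule proj_rel_contraction[OF A C])
qed (intro tendsto_add_zero assms proj_rel_error_tendsto)

lemma proj_rel_add:
  assumes A: "positive_op A" and C: "positive_op C" and "proj_rel A C x y" "proj_rel A C x' y'"
  shows "proj_rel A C (\<lambda>n. x n + x' n) (\<lambda>n. y n + y' n)"
  unfolding proj_rel_def
proof
  have "qnorm A (x n + x' n - (y n + y' n)) \<le> qnorm A (x n - y n) + qnorm A (x' n - y' n)" for n
    using qnorm_triangle[OF A, of "x n - y n" "x' n - y' n"] by (simp add: algebra_simps)
  then show "(\<lambda>n. qnorm A (x n + x' n - (y n + y' n))) \<longlonglongrightarrow> 0"
    by (rule qnorm_null_le[OF A]) (use assms(3,4) in \<open>auto simp: proj_rel_def intro: tendsto_add_zero\<close>)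
  show "(\<lambda>n. qnorm C (y n + y' n)) \<longlonglongrightarrow> 0"
    using qnorm_triangle[OF C]
    by (rule qnorm_null_le[OF C]) (use assms(3,4) in \<open>auto simp: proj_rel_def intro: tendsto_add_zero\<close>)
qed

lemma proj_rel_scaleC:
  assumes A: "positive_op A" and C: "positive_op C" and "proj_rel A C x y"
  shows "proj_rel A C (\<lambda>n. c *\<^sub>C x n) (\<lambda>n. c *\<^sub>C y n)"
  using assms(3)
  by (auto simp: proj_rel_def scaleC_diff_right[symmetric] qnorm_scaleC[OF A] qnorm_scaleC[OF C]
      intro: tendsto_mult_right_zero)

lemma proj_rel_idem: "proj_rel A C x y \<Longrightarrow> proj_rel A C y y"
  by (simp add: proj_rel_def qnorm_def)

text \<open>A diagonal choice: the splitting at the single vector \<open>x n\<close> is used up to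
  the tolerance \<open>1 / (n + 1)\<close>.\<close>

lemma proj_rel_exists:
  assumes A: "positive_op A" and C: "positive_op C" and split: "splitting A C"
  obtains y where "proj_rel A C x y"
proof -
  have "\<exists>z. qform A (x n - z) + qform C z < 1 / real (Suc n)" for n
  proof -
    obtain z where "proj_rel A C (\<lambda>_. x n) z" using split by (auto simp: splitting_def)
    from order_tendstoD(2)[OF proj_relD[OF A C this], of "1 / real (Suc n)"] show ?thesis
      by (auto dest: eventually_happens)
  qed
  then obtain y where "qform A (x n - y n) + qform C (y n) < 1 / real (Suc n)" for n by metis
  then show thesis
    by (intro that[of y] proj_relI[OF A C _ LIMSEQ_one_over_Suc] less_imp_le)
qed

lemma qnorm_null_cinner:
  assumes A: "positive_op A" and x: "(\<lambda>n. qnorm A (x n)) \<longlonglongrightarrow> 0" and y: "\<And>n. qnorm A (y n) \<le> K"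
  shows "(\<lambda>n. cinner (A (x n)) (y n)) \<longlonglongrightarrow> 0"
proof (rule tendsto_norm_zero_cancel, rule tendsto_sandwich[of "\<lambda>_. 0" _ _ "\<lambda>n. qnorm A (x n) * K"])
  have "cmod (cinner (A (x n)) (y n)) \<le> qnorm A (x n) * K" for n
    using positive_op_Cauchy_Schwarz[OF A, of "x n" "y n"] mult_left_mono[OF y[of n] qnorm_nonneg[OF A, of "x n"]]
    by linarith
  then show "\<forall>\<^sub>F n in sequentially. cmod (cinner (A (x n)) (y n)) \<le> qnorm A (x n) * K" by simp
  show "(\<lambda>n. qnorm A (x n) * K) \<longlonglongrightarrow> 0" using tendsto_mult_right[OF x, of K] by simp
qed simp_all

text \<open>The difference is \<open>(C y|z) - (A (x - y)|z)\<close>, in which each left vector is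
  null in its seminorm and \<open>z\<close> is bounded. Thus \<open>(Tx|z)\<close> is the limit of
  \<open>(A x|z)\<close>, an expression symmetric enough to give self-adjointness.\<close>

lemma proj_rel_cinner:
  assumes A: "positive_op A" and C: "positive_op C" and xy: "proj_rel A C x y"
    and z: "qCauchy (A + C) z"
  shows "(\<lambda>n. cinner ((A + C) (y n)) (z n) - cinner (A (x n)) (z n)) \<longlonglongrightarrow> 0"
proof -
  obtain K where K: "\<And>n. qnorm (A + C) (z n) \<le> K"
    using qCauchy_bounded[OF positive_op_add[OF A C] z] by blast
  have "(\<lambda>n. cinner (C (y n)) (z n) - cinner (A (x n - y n)) (z n)) \<longlonglongrightarrow> 0 - 0"
    by (intro tendsto_diff qnorm_null_cinner[OF A, of _ _ K] qnorm_null_cinner[OF C, of _ _ K]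
        order_trans[OF qnorm_le_qnorm_add_op(1)[OF A C] K] order_trans[OF qnorm_le_qnorm_add_op(2)[OF A C] K])
      (use xy in \<open>simp_all add: proj_rel_def\<close>)
  then show ?thesis
    by (simp add: blinfun.add_left blinfun.diff_right cinner_simps algebra_simps)
qed

section \<open>The auxiliary space\<close>

context
  fixes B :: "'a::complex_hilbert_space \<Rightarrow>\<^sub>L 'a"
  assumes B: "positive_op B"
begin

text \<open>Points of the completion are parametrised by sequences of preimages, so that all
  computations with them take place in the seminorm \<open>qnorm B\<close>.\<close>

definition aux_class :: "(nat \<Rightarrow> 'a) \<Rightarrow> (nat \<Rightarrow> 'a) set" where
  "aux_class x = cip_class (range_space B) (\<lambda>n. B (x n))"

text \<open>Self-adjointness moves \<open>B\<close> onto the preimage chosen by \<open>inv\<close>,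
  after which the choice no longer shows.\<close>

lemma Ip_range_space: "Ip (range_space B) (B x) (B y) = cinner (B x) y"
proof -
  have "B (inv (blinfun_apply B) (B y)) = B y" by (rule f_inv_into_f) simp
  then show ?thesis by (simp add: range_space_def positive_op_selfadjoint[OF B])
qed

lemma range_space_ops:
  "Carr (range_space B) = range (blinfun_apply B)"
  "Add (range_space B) (B x) (B y) = B (x + y)"
  "Scale (range_space B) c (B x) = B (c *\<^sub>C x)"
  by (simp_all add: range_space_def blinfun.add_right positive_op_scaleC[OF B])

lemma cip_dist_range_space: "cip_dist (range_space B) (B x) (B y) = qnorm B (x - y)"
  by (simp add: cip_dist_def cip_norm_def range_space_ops Ip_range_space scaleC_minus_one
      qnorm_def qform_def)

lemma cip_Cauchy_range_space:
  "s \<in> cip_Cauchy (range_space B) \<longleftrightarrow> (\<exists>x. s = (\<lambda>n. B (x n)) \<and> qCauchy B x)"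
proof
  assume s: "s \<in> cip_Cauchy (range_space B)"
  then have "\<forall>n. \<exists>z. s n = B z" by (auto simp: cip_Cauchy_def range_space_ops)
  then obtain x where "s = (\<lambda>n. B (x n))" by metis
  then show "\<exists>x. s = (\<lambda>n. B (x n)) \<and> qCauchy B x"
    using s by (auto simp: cip_Cauchy_def cip_dist_range_space qCauchy_def)
next
  assume "\<exists>x. s = (\<lambda>n. B (x n)) \<and> qCauchy B x"
  then show "s \<in> cip_Cauchy (range_space B)"
    by (auto simp: cip_Cauchy_def cip_dist_range_space range_space_ops qCauchy_def)
qed

lemma cip_equiv_range_space:
  assumes "qCauchy B x" "qCauchy B y"
  shows "(\<lambda>n. B (x n), \<lambda>n. B (y n)) \<in> cip_equiv (range_space B) \<longleftrightarrow>
    (\<lambda>n. qnorm B (x n - y n)) \<longlonglongrightarrow> 0"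
  using assms by (auto simp: cip_equiv_def cip_Cauchy_range_space cip_dist_range_space)

lemma qnorm_null_trans:
  assumes "(\<lambda>n. qnorm B (x n - y n)) \<longlonglongrightarrow> 0" "(\<lambda>n. qnorm B (y n - z n)) \<longlonglongrightarrow> 0"
  shows "(\<lambda>n. qnorm B (x n - z n)) \<longlonglongrightarrow> 0"
proof (rule qnorm_null_le[OF B])
  show "qnorm B (x n - z n) \<le> qnorm B (x n - y n) + qnorm B (y n - z n)" for n
    by (rule qnorm_triangle_diff[OF B])
qed (intro tendsto_add_zero assms)

lemma equiv_cip_equiv: "equiv (cip_Cauchy (range_space B)) (cip_equiv (range_space B))"
proof (rule equivI)
  show "cip_equiv (range_space B) \<subseteq> cip_Cauchy (range_space B) \<times> cip_Cauchy (range_space B)"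
    by (auto simp: cip_equiv_def)
  show "refl_on (cip_Cauchy (range_space B)) (cip_equiv (range_space B))"
    by (rule refl_onI) (auto simp: cip_Cauchy_range_space cip_equiv_range_space qnorm_def)
  show "sym (cip_equiv (range_space B))"
  proof (rule symI)
    fix s t assume "(s, t) \<in> cip_equiv (range_space B)"
    then obtain x y where "s = (\<lambda>n. B (x n))" "t = (\<lambda>n. B (y n))" "qCauchy B x" "qCauchy B y"
      "(s, t) \<in> cip_equiv (range_space B)"
      by (auto simp: cip_equiv_def cip_Cauchy_range_space)
    then show "(t, s) \<in> cip_equiv (range_space B)"
      by (simp add: cip_equiv_range_space qnorm_minus_commute)
  qed
  show "trans (cip_equiv (range_space B))"
  proof (rule transI)
    fix s t u assume "(s, t) \<in> cip_equiv (range_space B)" "(t, u) \<in> cip_equiv (range_space B)"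
    then obtain x y z where "s = (\<lambda>n. B (x n))" "t = (\<lambda>n. B (y n))" "u = (\<lambda>n. B (z n))"
      "qCauchy B x" "qCauchy B y" "qCauchy B z"
      "(s, t) \<in> cip_equiv (range_space B)" "(t, u) \<in> cip_equiv (range_space B)"
      by (auto simp: cip_equiv_def cip_Cauchy_range_space)
    then show "(s, u) \<in> cip_equiv (range_space B)"
      using qnorm_null_trans by (auto simp: cip_equiv_range_space)
  qed
qed

lemma aux_class_eq_iff:
  assumes "qCauchy B x" "qCauchy B y"
  shows "aux_class x = aux_class y \<longleftrightarrow> (\<lambda>n. qnorm B (x n - y n)) \<longlonglongrightarrow> 0"
  unfolding aux_class_def cip_class_def cip_equiv_range_space[OF assms, symmetric]
  using assms by (intro eq_equiv_class_iff[OF equiv_cip_equiv]) (auto simp: cip_Cauchy_range_space)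

lemma Carr_aux_space: "Carr (aux_space B) = aux_class ` {x. qCauchy B x}"
proof -
  have "cip_Cauchy (range_space B) = (\<lambda>x n. B (x n)) ` {x. qCauchy B x}"
    by (auto simp: cip_Cauchy_range_space)
  then show ?thesis
    by (auto simp: aux_space_def cip_completion_def quotient_def aux_class_def cip_class_def)
qed

lemma aux_class_in_Carr: "qCauchy B x \<Longrightarrow> aux_class x \<in> Carr (aux_space B)"
  by (auto simp: Carr_aux_space)

text \<open>The operations of the completion act on a chosen representative, of which nothing is
  known except that it is equivalent to the given one. Each formula for an operation below is first
  obtained for \<open>x'\<close> and then carried back to \<open>x\<close>.\<close>

lemma cip_rep_aux_class:
  assumes x: "qCauchy B x"
  obtains x' where "qCauchy B x'" "(\<lambda>n. qnorm B (x n - x' n)) \<longlonglongrightarrow> 0"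
    "cip_rep (aux_class x) = (\<lambda>n. B (x' n))"
proof -
  have "(\<lambda>n. B (x n)) \<in> aux_class x"
    using x by (simp add: aux_class_def cip_class_def cip_equiv_range_space qnorm_def)
  then have "cip_rep (aux_class x) \<in> aux_class x"
    unfolding cip_rep_def by (rule someI[of "\<lambda>s. s \<in> aux_class x"])
  then have rep: "(\<lambda>n. B (x n), cip_rep (aux_class x)) \<in> cip_equiv (range_space B)"
    by (simp add: aux_class_def cip_class_def)
  then obtain x' where "cip_rep (aux_class x) = (\<lambda>n. B (x' n))" "qCauchy B x'"
    by (auto simp: cip_equiv_def cip_Cauchy_range_space)
  then show thesis using that rep cip_equiv_range_space[OF x] by simp
qed

lemma Add_aux_class:
  assumes x: "qCauchy B x" and y: "qCauchy B y"
  shows "Add (aux_space B) (aux_class x) (aux_class y) = aux_class (\<lambda>n. x n + y n)"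
proof -
  obtain x' where x': "qCauchy B x'" "(\<lambda>n. qnorm B (x n - x' n)) \<longlonglongrightarrow> 0"
    "cip_rep (aux_class x) = (\<lambda>n. B (x' n))" using cip_rep_aux_class[OF x] .
  obtain y' where y': "qCauchy B y'" "(\<lambda>n. qnorm B (y n - y' n)) \<longlonglongrightarrow> 0"
    "cip_rep (aux_class y) = (\<lambda>n. B (y' n))" using cip_rep_aux_class[OF y] .
  have "Add (aux_space B) (aux_class x) (aux_class y) = aux_class (\<lambda>n. x' n + y' n)"
    by (simp add: aux_space_def cip_completion_def x' y' range_space_ops)
      (simp add: aux_class_def)
  also have "\<dots> = aux_class (\<lambda>n. x n + y n)"
  proof (subst aux_class_eq_iff)
    have "qnorm B (x' n + y' n - (x n + y n)) \<le> qnorm B (x n - x' n) + qnorm B (y n - y' n)" for n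
      using qnorm_triangle[OF B, of "x' n - x n" "y' n - y n"]
      by (simp add: algebra_simps qnorm_minus_commute[of B "x' n"] qnorm_minus_commute[of B "y' n"])
    then show "(\<lambda>n. qnorm B (x' n + y' n - (x n + y n))) \<longlonglongrightarrow> 0"
      by (rule qnorm_null_le[OF B]) (intro tendsto_add_zero x' y')
  qed (intro qCauchy_add B x y x' y')+
  finally show ?thesis .
qed

lemma Scale_aux_class:
  assumes x: "qCauchy B x"
  shows "Scale (aux_space B) c (aux_class x) = aux_class (\<lambda>n. c *\<^sub>C x n)"
proof -
  obtain x' where x': "qCauchy B x'" "(\<lambda>n. qnorm B (x n - x' n)) \<longlonglongrightarrow> 0"
    "cip_rep (aux_class x) = (\<lambda>n. B (x' n))" using cip_rep_aux_class[OF x] .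
  have "Scale (aux_space B) c (aux_class x) = aux_class (\<lambda>n. c *\<^sub>C x' n)"
    by (simp add: aux_space_def cip_completion_def x' range_space_ops)
      (simp add: aux_class_def)
  also have "\<dots> = aux_class (\<lambda>n. c *\<^sub>C x n)"
  proof (subst aux_class_eq_iff)
    show "(\<lambda>n. qnorm B (c *\<^sub>C x' n - c *\<^sub>C x n)) \<longlonglongrightarrow> 0"
      using x'(2) by (simp add: scaleC_diff_right[symmetric] qnorm_scaleC[OF B]
          qnorm_minus_commute[of B "x' _"] tendsto_mult_right_zero)
  qed (intro qCauchy_scaleC B x x')+
  finally show ?thesis .
qed

lemma qCauchy_cinner_convergent:
  assumes x: "qCauchy B x" and y: "qCauchy B y"
  shows "convergent (\<lambda>n. cinner (B (x n)) (y n))"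
proof (rule Cauchy_convergent, rule CauchyI)
  fix e :: real assume "0 < e"
  obtain K where K: "0 < K" "\<And>n. qnorm B (x n) \<le> K" using qCauchy_bounded[OF B x] by blast
  obtain L where L: "0 < L" "\<And>n. qnorm B (y n) \<le> L" using qCauchy_bounded[OF B y] by blast
  have "0 < e / (2 * L)" "0 < e / (2 * K)" using K L \<open>0 < e\<close> by simp_all
  then obtain M N where M: "\<forall>m\<ge>M. \<forall>n\<ge>M. qnorm B (x m - x n) < e / (2 * L)"
    and N: "\<forall>m\<ge>N. \<forall>n\<ge>N. qnorm B (y m - y n) < e / (2 * K)"
    using x y unfolding qCauchy_def by metis
  have "cmod (cinner (B (x m)) (y m) - cinner (B (x n)) (y n)) < e"
    if "m \<ge> max M N" "n \<ge> max M N" for m n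
  proof -
    have "cinner (B (x m)) (y m) - cinner (B (x n)) (y n)
        = cinner (B (x m - x n)) (y m) + cinner (B (x n)) (y m - y n)"
      by (simp add: blinfun.diff_right cinner_simps)
    then have "cmod (cinner (B (x m)) (y m) - cinner (B (x n)) (y n))
        \<le> qnorm B (x m - x n) * qnorm B (y m) + qnorm B (x n) * qnorm B (y m - y n)"
      by (simp add: norm_triangle_le add_mono positive_op_Cauchy_Schwarz[OF B])
    also have "\<dots> \<le> qnorm B (x m - x n) * L + K * qnorm B (y m - y n)"
      by (intro add_mono mult_left_mono mult_right_mono K L qnorm_nonneg B)
    also have "\<dots> < e / (2 * L) * L + K * (e / (2 * K))"
      using M N that K L by (intro add_strict_mono mult_strict_right_mono mult_strict_left_mono) auto
    also have "\<dots> = e" using K L by simp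
    finally show ?thesis .
  qed
  then show "\<exists>N. \<forall>m\<ge>N. \<forall>n\<ge>N. norm (cinner (B (x m)) (y m) - cinner (B (x n)) (y n)) < e" by blast
qed

lemma Ip_aux_class:
  assumes x: "qCauchy B x" and y: "qCauchy B y"
  shows "(\<lambda>n. cinner (B (x n)) (y n)) \<longlonglongrightarrow> Ip (aux_space B) (aux_class x) (aux_class y)"
proof -
  obtain x' where x': "qCauchy B x'" "(\<lambda>n. qnorm B (x n - x' n)) \<longlonglongrightarrow> 0"
    "cip_rep (aux_class x) = (\<lambda>n. B (x' n))" using cip_rep_aux_class[OF x] .
  obtain y' where y': "qCauchy B y'" "(\<lambda>n. qnorm B (y n - y' n)) \<longlonglongrightarrow> 0"
    "cip_rep (aux_class y) = (\<lambda>n. B (y' n))" using cip_rep_aux_class[OF y] .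
  obtain K where K: "\<And>n. qnorm B (x' n) \<le> K" using qCauchy_bounded[OF B x'(1)] by blast
  obtain L where L: "\<And>n. qnorm B (y n) \<le> L" using qCauchy_bounded[OF B y] by blast
  have lim': "(\<lambda>n. cinner (B (x' n)) (y' n)) \<longlonglongrightarrow> Ip (aux_space B) (aux_class x) (aux_class y)"
    using qCauchy_cinner_convergent[OF x'(1) y'(1)]
    by (simp add: aux_space_def cip_completion_def x' y' Ip_range_space convergent_LIMSEQ_iff)
  \<comment> \<open>The representatives are exchanged one factor at a time. The second term is
    conjugated in order to have its null sequence in the argument of \<open>B\<close>.\<close>
  have "(\<lambda>n. cinner (B (x n - x' n)) (y n) + cnj (cinner (B (y n - y' n)) (x' n))) \<longlonglongrightarrow> 0 + cnj 0"
    by (intro tendsto_add tendsto_cnj qnorm_null_cinner[OF B x'(2) L] qnorm_null_cinner[OF B y'(2) K])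
  moreover have "cinner (B (x n - x' n)) (y n) + cnj (cinner (B (y n - y' n)) (x' n))
      = cinner (B (x n)) (y n) - cinner (B (x' n)) (y' n)" for n
    unfolding cinner_commute[of "x' n", symmetric]
    by (simp add: blinfun.diff_right cinner_simps positive_op_selfadjoint[OF B])
  ultimately have "(\<lambda>n. cinner (B (x n)) (y n) - cinner (B (x' n)) (y' n)) \<longlonglongrightarrow> 0" by simp
  from tendsto_add[OF this lim'] show ?thesis by simp
qed

lemma cip_norm_aux_class:
  assumes x: "qCauchy B x"
  shows "(\<lambda>n. qnorm B (x n)) \<longlonglongrightarrow> cip_norm (aux_space B) (aux_class x)"
  unfolding cip_norm_def qnorm_def qform_def
  by (intro tendsto_intros Ip_aux_class x)

lemma aux_J_aux_class:
  assumes x: "qCauchy B x"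
  shows "(\<lambda>n. B (x n)) \<longlonglongrightarrow> aux_J B (aux_class x)"
proof -
  obtain x' where x': "qCauchy B x'" "(\<lambda>n. qnorm B (x n - x' n)) \<longlonglongrightarrow> 0"
    "cip_rep (aux_class x) = (\<lambda>n. B (x' n))" using cip_rep_aux_class[OF x] .
  have "(\<lambda>n. B (x' n)) \<longlonglongrightarrow> aux_J B (aux_class x)"
    using qCauchy_image_convergent[OF B x'(1)] by (simp add: aux_J_def x' convergent_LIMSEQ_iff)
  from tendsto_add[OF qnorm_null_image[OF B x'(2)] this] show ?thesis
    by (simp add: blinfun.diff_right)
qed

lemma aux_J_adj_eq: "aux_J_adj B x = aux_class (\<lambda>n. x)"
  unfolding aux_J_adj_def
proof (rule the_equality)
  have adj: "cinner (aux_J B h) x = Ip (aux_space B) h (aux_class (\<lambda>n. x))"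
    if h: "h \<in> Carr (aux_space B)" for h
  proof -
    obtain z where z: "qCauchy B z" "h = aux_class z" using h by (auto simp: Carr_aux_space)
    show ?thesis
      using LIMSEQ_unique[OF tendsto_cinner[OF aux_J_aux_class[OF z(1)] tendsto_const[of x]]
          Ip_aux_class[OF z(1) qCauchy_const]] by (simp add: z)
  qed
  then show "aux_class (\<lambda>n. x) \<in> Carr (aux_space B) \<and>
      (\<forall>h\<in>Carr (aux_space B). cinner (aux_J B h) x = Ip (aux_space B) h (aux_class (\<lambda>n. x)))"
    by (simp add: aux_class_in_Carr qCauchy_const)
  fix k assume k: "k \<in> Carr (aux_space B) \<and>
      (\<forall>h\<in>Carr (aux_space B). cinner (aux_J B h) x = Ip (aux_space B) h k)"
  then obtain y where y: "qCauchy B y" "k = aux_class y" by (auto simp: Carr_aux_space)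
  \<comment> \<open>\<open>z\<close> represents the difference of \<open>k\<close> and the
    candidate; testing the adjoint identity on this difference makes its norm 0.\<close>
  define z where "z n = y n + (-1) *\<^sub>C x" for n
  have z: "qCauchy B z"
    unfolding z_def by (intro qCauchy_add B y qCauchy_const)
  have "Ip (aux_space B) (aux_class z) k = Ip (aux_space B) (aux_class z) (aux_class (\<lambda>n. x))"
    using k adj aux_class_in_Carr[OF z] by metis
  then have "(\<lambda>n. cinner (B (z n)) (y n) - cinner (B (z n)) x) \<longlonglongrightarrow> 0"
    using tendsto_diff[OF Ip_aux_class[OF z y(1)] Ip_aux_class[OF z qCauchy_const[of B x]]]
    by (simp add: y(2))
  from tendsto_Re[OF this] have "(\<lambda>n. qform B (z n)) \<longlonglongrightarrow> 0"
    by (simp add: qform_def z_def scaleC_minus_one cinner_simps)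
  then show "k = aux_class (\<lambda>n. x)"
    unfolding y(2) aux_class_eq_iff[OF y(1) qCauchy_const]
    by (simp add: tendsto_qform_zero_iff[OF B] z_def scaleC_minus_one)
qed

end

section \<open>Splittings and projections on the auxiliary space\<close>

lemma splitting_imp_projection:
  assumes A: "positive_op A" and C: "positive_op C" and split: "splitting A C"
  shows "\<exists>P. orthogonal_projection_on (aux_space (A + C)) P \<and>
    (\<forall>x. A x = aux_J (A + C) (P (aux_J_adj (A + C) x)))"
proof -
  define B where "B = A + C"
  have B: "positive_op B" unfolding B_def by (intro positive_op_add A C)
  \<comment> \<open>\<open>proj_rel\<close> relates sequences, whereas \<open>P\<close> must act on
    classes. \<open>Q\<close> allows every representative of \<open>k\<close>;
    \<open>proj_rel_cong\<close> shows that the class of the chosen \<open>y\<close> does not depend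
    on the choices.\<close>
  define Q where "Q k y \<longleftrightarrow> (\<exists>x. qCauchy B x \<and> k = aux_class B x \<and> qCauchy B y \<and> proj_rel A C x y)" for k y
  define P where "P k = aux_class B (SOME y. Q k y)" for k
  have P: "P (aux_class B x) = aux_class B y"
    if x: "qCauchy B x" and y: "qCauchy B y" and xy: "proj_rel A C x y" for x y
  proof -
    have "Q (aux_class B x) (SOME y. Q (aux_class B x) y)"
      by (rule someI[of _ y]) (use that in \<open>auto simp: Q_def\<close>)
    then obtain x' where x': "qCauchy B x'" "aux_class B x = aux_class B x'"
      and y': "qCauchy B (SOME y. Q (aux_class B x) y)"
      and xy': "proj_rel A C x' (SOME y. Q (aux_class B x) y)"
      by (auto simp: Q_def)
    have "(\<lambda>n. qnorm B (x' n - x n)) \<longlonglongrightarrow> 0"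
      using x'(2) aux_class_eq_iff[OF B x'(1) x] by simp
    then show ?thesis
      unfolding P_def aux_class_eq_iff[OF B y' y]
      using proj_rel_cong[OF A C xy' xy] by (simp add: B_def)
  qed
  have ex: "\<exists>y. qCauchy B y \<and> proj_rel A C x y" if "qCauchy B x" for x
    using proj_rel_exists[OF A C split, of x] proj_rel_qCauchy[OF A C] that unfolding B_def by metis
  have elim: "\<exists>x y. k = aux_class B x \<and> qCauchy B x \<and> qCauchy B y \<and> proj_rel A C x y \<and> P k = aux_class B y"
    if "k \<in> Carr (aux_space B)" for k
    using that ex P unfolding Carr_aux_space[OF B] by blast
  have "orthogonal_projection_on (aux_space B) P"
    unfolding orthogonal_projection_on_def
  proof (intro conjI ballI allI)
    fix k assume "k \<in> Carr (aux_space B)"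
    then obtain x y where k: "k = aux_class B x" "qCauchy B x" "qCauchy B y" "proj_rel A C x y" "P k = aux_class B y"
      using elim by blast
    show "P k \<in> Carr (aux_space B)" using k aux_class_in_Carr[OF B] by simp
    show "P (P k) = P k" using P[OF k(3,3) proj_rel_idem[OF k(4)]] k(5) by simp
    show "P (Scale (aux_space B) c k) = Scale (aux_space B) c (P k)" for c
      unfolding k(5) unfolding k(1) Scale_aux_class[OF B k(2)] Scale_aux_class[OF B k(3)]
      by (intro P qCauchy_scaleC proj_rel_scaleC A B C k)
    fix l assume "l \<in> Carr (aux_space B)"
    then obtain z w where l: "l = aux_class B z" "qCauchy B z" "qCauchy B w" "proj_rel A C z w" "P l = aux_class B w"
      using elim by blast
    show "P (Add (aux_space B) k l) = Add (aux_space B) (P k) (P l)"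
      unfolding k(5) l(5) unfolding k(1) l(1) Add_aux_class[OF B k(2) l(2)] Add_aux_class[OF B k(3) l(3)]
      by (intro P qCauchy_add proj_rel_add A B C k l)
    \<comment> \<open>Both inner products in the symmetry condition are identified with the limit of
      \<open>(A x|z)\<close>.\<close>
    have 1: "(\<lambda>n. cinner (A (x n)) (z n)) \<longlonglongrightarrow> Ip (aux_space B) (P k) l"
      using tendsto_diff[OF Ip_aux_class[OF B k(3) l(2)] proj_rel_cinner[OF A C k(4) l(2)[unfolded B_def]]]
      unfolding k(5) l(1) by (simp add: B_def)
    have "(\<lambda>n. cnj (cinner (B (w n)) (x n) - cinner (A (z n)) (x n))) \<longlonglongrightarrow> cnj 0"
      using proj_rel_cinner[OF A C l(4) k(2)[unfolded B_def]] unfolding B_def by (rule tendsto_cnj)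
    then have "(\<lambda>n. cinner (B (x n)) (w n) - cinner (A (x n)) (z n)) \<longlonglongrightarrow> 0"
      unfolding complex_cnj_diff cinner_commute[of "x _", symmetric]
      by (simp add: positive_op_selfadjoint[OF A] positive_op_selfadjoint[OF B])
    from tendsto_diff[OF Ip_aux_class[OF B k(2) l(3)] this]
    have 2: "(\<lambda>n. cinner (A (x n)) (z n)) \<longlonglongrightarrow> Ip (aux_space B) k (P l)"
      unfolding l(5) k(1) by simp
    show "Ip (aux_space B) (P k) l = Ip (aux_space B) k (P l)" by (rule LIMSEQ_unique[OF 1 2])
  next
    show "\<exists>M. \<forall>k\<in>Carr (aux_space B). cip_norm (aux_space B) (P k) \<le> M * cip_norm (aux_space B) k"
    proof (intro exI[of _ 1] ballI)
      fix k assume "k \<in> Carr (aux_space B)"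
      then obtain x y where k: "k = aux_class B x" "qCauchy B x" "qCauchy B y" "proj_rel A C x y" "P k = aux_class B y"
        using elim by blast
      have "cip_norm (aux_space B) (aux_class B y) \<le> cip_norm (aux_space B) (aux_class B x) + 0 + 0"
      proof (rule LIMSEQ_le[OF cip_norm_aux_class[OF B k(3)]])
        show "(\<lambda>n. qnorm B (x n) + (qnorm A (x n - y n) + qnorm C (y n)) + 0)
            \<longlonglongrightarrow> cip_norm (aux_space B) (aux_class B x) + 0 + 0"
          by (intro tendsto_add tendsto_const cip_norm_aux_class[OF B k(2)] proj_rel_error_tendsto[OF k(4)])
        \<comment> \<open>The contraction estimate is taken against the zero vector, which the
          relation sends to zero; this is why the bound 1 works.\<close>
        have "qnorm B (y n) \<le> qnorm B (x n) + (qnorm A (x n - y n) + qnorm C (y n)) + 0" for n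
          using proj_rel_contraction[OF A C, of "y n" 0 "x n" 0] by (simp add: B_def qnorm_def)
        then show "\<exists>N. \<forall>n\<ge>N. qnorm B (y n) \<le> qnorm B (x n) + (qnorm A (x n - y n) + qnorm C (y n)) + 0"
          by blast
      qed
      then show "cip_norm (aux_space B) (P k) \<le> 1 * cip_norm (aux_space B) k"
        unfolding k(5) unfolding k(1) by simp
    qed
  qed
  moreover have "A x = aux_J B (P (aux_J_adj B x))" for x
  proof -
    obtain y where y: "qCauchy B y" "proj_rel A C (\<lambda>n. x) y" using ex[OF qCauchy_const] by blast
    have "(\<lambda>n. A x - A (x - y n) + C (y n)) \<longlonglongrightarrow> A x - 0 + 0"
      using y(2) by (intro tendsto_intros qnorm_null_image A C) (simp_all add: proj_rel_def)
    then have "(\<lambda>n. B (y n)) \<longlonglongrightarrow> A x" by (simp add: B_def blinfun.add_left blinfun.diff_right)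
    then show ?thesis
      unfolding aux_J_adj_eq[OF B] P[OF qCauchy_const y]
      using aux_J_aux_class[OF B y(1)] LIMSEQ_unique by blast
  qed
  ultimately show ?thesis unfolding B_def by blast
qed

text \<open>\<open>y\<close> represents the image of \<open>x\<close> under the projection. Then
  \<open>B (y n)\<close> tends to \<open>A x\<close>, and self-adjointness with idempotence gives
  that \<open>qform B (y n)\<close> tends to \<open>qform A x\<close>. These two limits determine
  that of the expanded functional.\<close>

lemma projection_imp_splitting:
  assumes A: "positive_op A" and C: "positive_op C"
    and P: "orthogonal_projection_on (aux_space (A + C)) P"
    and AP: "\<And>x. A x = aux_J (A + C) (P (aux_J_adj (A + C) x))"
  shows "splitting A C"
  unfolding splitting_def
proof
  fix x
  define B where "B = A + C"
  have B: "positive_op B" unfolding B_def by (intro positive_op_add A C)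
  let ?k = "aux_class B (\<lambda>n. x)"
  have k: "?k \<in> Carr (aux_space B)" by (intro aux_class_in_Carr B qCauchy_const)
  then have "P ?k \<in> Carr (aux_space B)"
    and idem: "P (P ?k) = P ?k"
    using P by (simp_all add: orthogonal_projection_on_def B_def)
  then obtain y where y: "qCauchy B y" "P ?k = aux_class B y" by (auto simp: Carr_aux_space[OF B])
  have By: "(\<lambda>n. B (y n)) \<longlonglongrightarrow> A x"
    using aux_J_aux_class[OF B y(1)] AP[of x] by (simp add: y(2) aux_J_adj_eq[OF B] B_def[symmetric])
  have "Ip (aux_space B) (P ?k) (P ?k) = Ip (aux_space B) ?k (P ?k)"
    using P k \<open>P ?k \<in> Carr (aux_space B)\<close> idem unfolding orthogonal_projection_on_def B_def by metis
  moreover have "(\<lambda>n. cinner (B x) (y n)) \<longlonglongrightarrow> Ip (aux_space B) ?k (P ?k)"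
    unfolding y(2) by (intro Ip_aux_class B qCauchy_const y)
  moreover have "(\<lambda>n. cinner (B x) (y n)) \<longlonglongrightarrow> cinner x (A x)"
    unfolding positive_op_selfadjoint[OF B] by (intro tendsto_intros By)
  ultimately have "(\<lambda>n. cinner (B (y n)) (y n)) \<longlonglongrightarrow> cinner (A x) x"
    using Ip_aux_class[OF B y(1,1)] LIMSEQ_unique unfolding y(2) positive_op_selfadjoint[OF A] by metis
  then have lim: "(\<lambda>n. qform B (y n)) \<longlonglongrightarrow> qform A x"
    unfolding qform_def by (rule tendsto_Re)
  \<comment> \<open>The cross term \<open>(A x|y n)\<close> is written as the residual pairing plus
    \<open>qform B (y n)\<close>, since \<open>B (y n)\<close> tending to \<open>A x\<close> gives
    no direct control over pairings with a possibly unbounded \<open>y n\<close>.\<close>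
  have "(\<lambda>n. qform A x - 2 * (Re (cinner (A x - B (y n)) (y n)) + qform B (y n)) + qform B (y n))
      \<longlonglongrightarrow> qform A x - 2 * (Re 0 + qform A x) + qform A x"
    by (intro tendsto_intros lim qCauchy_residual_tendsto B y By)
  then show "\<exists>y. proj_rel A C (\<lambda>n. x) y"
  proof (intro exI[of _ y] proj_relI[OF A C])
    show "qform A (x - y n) + qform C (y n)
        \<le> qform A x - 2 * (Re (cinner (A x - B (y n)) (y n)) + qform B (y n)) + qform B (y n)" for n
      by (simp add: qform_diff[OF A] B_def qform_add_op qform_def[of B] cinner_simps blinfun.add_left)
        (simp add: qform_def)
  qed simp
qed

theorem theorem3:
  fixes A B :: "'a::complex_hilbert_space \<Rightarrow>\<^sub>L 'a"
  assumes "positive_op A" and "positive_op B" and "A \<preceq> B"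
  shows "(A = generalized_short A B \<longleftrightarrow>
            (\<exists>P. orthogonal_projection_on (aux_space B) P \<and>
                 (\<forall>x. A x = aux_J B (P (aux_J_adj B x))))) \<and>
         (A = generalized_short A B \<longleftrightarrow> A extreme_point_of (op_interval 0 B)) \<and>
         (A = generalized_short A B \<longleftrightarrow> singular_ops A (B - A))"
proof -
  have C: "positive_op (B - A)" using assms(3) by (simp add: op_le_def)
  have B: "A + (B - A) = B" by simp
  have "(\<exists>P. orthogonal_projection_on (aux_space B) P \<and>
      (\<forall>x. A x = aux_J B (P (aux_J_adj B x)))) \<longleftrightarrow> splitting A (B - A)"
    using splitting_imp_projection[OF assms(1) C] projection_imp_splitting[OF assms(1) C]
    unfolding B by blast
  then show ?thesis
    using generalized_short_iff_splitting[OF assms(1) C] extreme_point_iff_splitting[OF assms(1) C]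
      singular_ops_iff_splitting[OF assms(1) C]
    unfolding B by blast
qed

end
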